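(* Let $\beta>2$, let $W$ be a centred Gaussian random element of the Hilbert space $\mathcal{H}=L^2(\mathbb{R},\mathcal{B},e^{-\beta t^2}\,dt)$ with covariance kernel $$K(s,t)=e^{(t^2+s^2)/2}\left(e^{ts}-1-ts-\frac{t^2s^2}{2}\right),\quad s,t\in\mathbb{R},$$ and let $T_\infty=\|W\|^2=\int_{\mathbb{R}}W^2(t)e^{-\beta t^2}\,dt$. Then: a) $$\mathbb{E}(T_\infty)=\frac{\sqrt{\pi}}{\sqrt{\beta-2}}-\frac{\sqrt{\pi}}{\sqrt{\beta-1}}\left(1+\frac{1}{2(\beta-1)}+\frac{3}{8(\beta-1)^2}\right);$$ b) $$\mathbb{V}(T_\infty)=2\pi\left(\frac{1}{\sqrt{\beta}\sqrt{\beta-2}}-\frac{4}{\sqrt{\gamma}}-\frac{6}{\gamma^{3/2}}-\frac{6}{\gamma^{5/2}}+\frac{1}{\beta-1}+\frac{1}{2(\beta-1)^3}+\frac{9}{64(\beta-1)^5}\right),$$ where $\gamma=4(\beta-1)^2-1$.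
   Context: $\mathbb{E}$ and $\mathbb{V}$ denote expectation and variance. $\mathcal{B}$ is the Borel $\sigma$-field on $\mathbb{R}$. $\mathcal{H}$ is the separable Hilbert space of (equivalence classes of) measurable functions $f:\mathbb{R}\to\mathbb{R}$ with $\int_{\mathbb{R}} f^2(t)e^{-\beta t^2}\,dt<\infty$, with inner product $\langle f,g\rangle=\int_{\mathbb{R}} f(t)g(t)e^{-\beta t^2}\,dt$ and norm $\|f\|=\langle f,f\rangle^{1/2}$. A centred Gaussian element $W$ of $\mathcal{H}$ has covariance kernel $K$ if, for all $f,g\in\mathcal{H}$, $\langle W,f\rangle$ is a centred (possibly degenerate) normal random variable and $\mathbb{E}[\langle W,f\rangle\langle W,g\rangle]=\int_{\mathbb{R}}\int_{\mathbb{R}}K(s,t)f(s)g(t)e^{-\beta s^2}e^{-\beta t^2}\,ds\,dt$. *)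

theory Defs
  imports "HOL-Probability.Probability"
begin

text \<open>
  The measure \<open>exp (- \<beta> * t\<^sup>2) dt\<close> has the same null sets as Lebesgue measure, so the
  equivalence classes do not depend on \<open>\<beta>\<close>; only the integrability condition that cuts out the
  Hilbert space does.
\<close>

definition ae_eq :: "(real \<Rightarrow> real) \<Rightarrow> (real \<Rightarrow> real) \<Rightarrow> bool" where
  "ae_eq f g \<longleftrightarrow> f \<in> borel_measurable borel \<and> g \<in> borel_measurable borel \<and>
     (AE t in lborel. f t = g t)"

lemma part_equivp_ae_eq: "part_equivp ae_eq"
proof (rule part_equivpI)
  show "\<exists>f. ae_eq f f" by (intro exI[of _ "\<lambda>_. 0"]) (simp add: ae_eq_def)
  show "symp ae_eq" by (auto simp: symp_def ae_eq_def elim: eventually_mono)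
  show "transp ae_eq"
  proof (rule transpI)
    fix f g h assume *: "ae_eq f g" "ae_eq g h"
    then have "AE t in lborel. f t = g t" "AE t in lborel. g t = h t"
      by (simp_all add: ae_eq_def)
    then have "AE t in lborel. f t = h t" by eventually_elim simp
    with * show "ae_eq f h" by (simp add: ae_eq_def)
  qed
qed

quotient_type ae_fun = "real \<Rightarrow> real" / partial: ae_eq
  morphisms rep_ae_fun ae_class
  by (rule part_equivp_ae_eq)

instantiation ae_fun :: real_vector
begin

lift_definition zero_ae_fun :: ae_fun is "\<lambda>_. 0"
  by (simp add: ae_eq_def)

lift_definition plus_ae_fun :: "ae_fun \<Rightarrow> ae_fun \<Rightarrow> ae_fun" is "\<lambda>f g t. f t + g t"
  by (auto simp: ae_eq_def)

lift_definition minus_ae_fun :: "ae_fun \<Rightarrow> ae_fun \<Rightarrow> ae_fun" is "\<lambda>f g t. f t - g t"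
  by (auto simp: ae_eq_def)

lift_definition uminus_ae_fun :: "ae_fun \<Rightarrow> ae_fun" is "\<lambda>f t. - f t"
  by (auto simp: ae_eq_def)

lift_definition scaleR_ae_fun :: "real \<Rightarrow> ae_fun \<Rightarrow> ae_fun" is "\<lambda>c f t. c * f t"
  by (auto simp: ae_eq_def)

instance
  by standard (transfer; auto simp: ae_eq_def algebra_simps)+

end

lift_definition square_integrable :: "real \<Rightarrow> ae_fun \<Rightarrow> bool" is
  "\<lambda>\<beta> f. integrable lborel (\<lambda>t. (f t)\<^sup>2 * exp (- \<beta> * t\<^sup>2))"
  by (intro integrable_cong_AE) (auto simp: ae_eq_def)

definition L2 :: "real \<Rightarrow> ae_fun set" where
  "L2 \<beta> = {f. square_integrable \<beta> f}"

lift_definition L2_inner :: "real \<Rightarrow> ae_fun \<Rightarrow> ae_fun \<Rightarrow> real" is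
  "\<lambda>\<beta> f g. LINT t|lborel. f t * g t * exp (- \<beta> * t\<^sup>2)"
  by (intro integral_cong_AE) (auto simp: ae_eq_def)

definition L2_norm :: "real \<Rightarrow> ae_fun \<Rightarrow> real" where
  "L2_norm \<beta> f = sqrt (L2_inner \<beta> f f)"

definition L2_dist :: "real \<Rightarrow> ae_fun \<Rightarrow> ae_fun \<Rightarrow> real" where
  "L2_dist \<beta> f g = L2_norm \<beta> (f - g)"

lemma ae_class_in_L2_iff:
  assumes "f \<in> borel_measurable borel"
  shows "ae_class f \<in> L2 \<beta> \<longleftrightarrow> integrable lborel (\<lambda>t. (f t)\<^sup>2 * exp (- \<beta> * t\<^sup>2))"
  using assms square_integrable.abs_eq[of f \<beta>] by (simp add: L2_def ae_eq_def)

lemma L2_inner_ae_class: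
  assumes "f \<in> borel_measurable borel" "g \<in> borel_measurable borel"
  shows "L2_inner \<beta> (ae_class f) (ae_class g) = (LINT t|lborel. f t * g t * exp (- \<beta> * t\<^sup>2))"
  using assms by (intro L2_inner.abs_eq) (simp_all add: ae_eq_def)

lemma L2_norm_power2_ae_class:
  assumes "f \<in> borel_measurable borel"
  shows "(L2_norm \<beta> (ae_class f))\<^sup>2 = (LINT t|lborel. (f t)\<^sup>2 * exp (- \<beta> * t\<^sup>2))"
  using assms
  by (simp add: L2_norm_def L2_inner_ae_class power2_eq_square)

lemma integrable_mult_of_square_integrable:
  fixes f g :: "real \<Rightarrow> real"
  assumes [measurable]: "f \<in> borel_measurable borel" "g \<in> borel_measurable borel"
    and f: "integrable lborel (\<lambda>t. (f t)\<^sup>2 * exp (- \<beta> * t\<^sup>2))"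
    and g: "integrable lborel (\<lambda>t. (g t)\<^sup>2 * exp (- \<beta> * t\<^sup>2))"
  shows "integrable lborel (\<lambda>t. f t * g t * exp (- \<beta> * t\<^sup>2))"
proof (rule Bochner_Integration.integrable_bound)
  show "integrable lborel (\<lambda>t. (f t)\<^sup>2 * exp (- \<beta> * t\<^sup>2) + (g t)\<^sup>2 * exp (- \<beta> * t\<^sup>2))"
    using f g by simp
  have "\<bar>f t * g t\<bar> \<le> (f t)\<^sup>2 + (g t)\<^sup>2" for t
  proof -
    have "2 * (\<bar>f t\<bar> * \<bar>g t\<bar>) \<le> (f t)\<^sup>2 + (g t)\<^sup>2"
      using sum_squares_bound[of "\<bar>f t\<bar>" "\<bar>g t\<bar>"] by simp
    moreover have "0 \<le> \<bar>f t\<bar> * \<bar>g t\<bar>" by simp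
    ultimately show ?thesis unfolding abs_mult by linarith
  qed
  then have "\<bar>f t * g t\<bar> * exp (- \<beta> * t\<^sup>2) \<le> ((f t)\<^sup>2 + (g t)\<^sup>2) * exp (- \<beta> * t\<^sup>2)" for t
    by (intro mult_right_mono) simp_all
  then show "AE t in lborel. norm (f t * g t * exp (- \<beta> * t\<^sup>2))
      \<le> norm ((f t)\<^sup>2 * exp (- \<beta> * t\<^sup>2) + (g t)\<^sup>2 * exp (- \<beta> * t\<^sup>2))"
    by (intro AE_I2) (simp add: abs_mult algebra_simps)
qed measurable

lemma L2_inner_nonneg: "0 \<le> L2_inner \<beta> f f"
  by transfer (auto intro!: integral_nonneg_AE)

lemma L2_norm_power2: "(L2_norm \<beta> f)\<^sup>2 = L2_inner \<beta> f f"
  by (simp add: L2_norm_def L2_inner_nonneg)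

lemma L2_inner_commute: "L2_inner \<beta> f g = L2_inner \<beta> g f"
  by transfer (simp add: mult.commute)

lemma L2_inner_add_scaleR_left:
  "f \<in> L2 \<beta> \<Longrightarrow> g \<in> L2 \<beta> \<Longrightarrow> h \<in> L2 \<beta> \<Longrightarrow>
    L2_inner \<beta> (f + c *\<^sub>R g) h = L2_inner \<beta> f h + c * L2_inner \<beta> g h"
  unfolding L2_def mem_Collect_eq
proof (transfer, goal_cases)
  case (1 \<beta> f g h c)
  then have "integrable lborel (\<lambda>t. f t * h t * exp (- \<beta> * t\<^sup>2))"
    "integrable lborel (\<lambda>t. g t * h t * exp (- \<beta> * t\<^sup>2))"
    by (auto intro!: integrable_mult_of_square_integrable[unfolded mult_minus_left] simp: ae_eq_def)
  then have "(LINT t|lborel. f t * h t * exp (- \<beta> * t\<^sup>2) + c * (g t * h t * exp (- \<beta> * t\<^sup>2)))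
      = (LINT t|lborel. f t * h t * exp (- \<beta> * t\<^sup>2)) + c * (LINT t|lborel. g t * h t * exp (- \<beta> * t\<^sup>2))"
    by simp
  then show ?case by (simp add: algebra_simps)
qed

lemma L2_add_scaleR: "f \<in> L2 \<beta> \<Longrightarrow> g \<in> L2 \<beta> \<Longrightarrow> f + c *\<^sub>R g \<in> L2 \<beta>"
  unfolding L2_def mem_Collect_eq
proof (transfer, goal_cases)
  case (1 \<beta> f g c)
  then have "integrable lborel (\<lambda>t. f t * g t * exp (- \<beta> * t\<^sup>2))"
    by (auto intro!: integrable_mult_of_square_integrable[unfolded mult_minus_left] simp: ae_eq_def)
  with 1 have "integrable lborel (\<lambda>t. (f t)\<^sup>2 * exp (- \<beta> * t\<^sup>2)
      + 2 * c * (f t * g t * exp (- \<beta> * t\<^sup>2)) + c\<^sup>2 * ((g t)\<^sup>2 * exp (- \<beta> * t\<^sup>2)))"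
    by simp
  then show ?case by (simp add: algebra_simps power2_eq_square)
qed

lemma L2_diff: "f \<in> L2 \<beta> \<Longrightarrow> g \<in> L2 \<beta> \<Longrightarrow> f - g \<in> L2 \<beta>"
  using L2_add_scaleR[of f \<beta> g "-1"] by simp

lemma L2_inner_add_scaleR_self:
  assumes "f \<in> L2 \<beta>" "g \<in> L2 \<beta>"
  shows "L2_inner \<beta> (f + c *\<^sub>R g) (f + c *\<^sub>R g)
    = L2_inner \<beta> f f + 2 * c * L2_inner \<beta> f g + c\<^sup>2 * L2_inner \<beta> g g"
proof -
  note [simp] = assms L2_add_scaleR
  have "L2_inner \<beta> f (f + c *\<^sub>R g) = L2_inner \<beta> f f + c * L2_inner \<beta> f g"
    "L2_inner \<beta> g (f + c *\<^sub>R g) = L2_inner \<beta> f g + c * L2_inner \<beta> g g"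
    by (simp_all add: L2_inner_commute[of \<beta> _ "f + c *\<^sub>R g"] L2_inner_add_scaleR_left
        L2_inner_commute[of \<beta> g f])
  then show ?thesis
    by (simp add: L2_inner_add_scaleR_left power2_eq_square algebra_simps)
qed

lemma L2_inner_eq_zero_iff: "f \<in> L2 \<beta> \<Longrightarrow> L2_inner \<beta> f f = 0 \<longleftrightarrow> f = 0"
  unfolding L2_def mem_Collect_eq
proof (transfer, goal_cases)
  case (1 \<beta> f)
  then have "integrable lborel (\<lambda>t. f t * f t * exp (- \<beta> * t\<^sup>2))"
    by (simp add: power2_eq_square)
  then have "(LINT t|lborel. f t * f t * exp (- \<beta> * t\<^sup>2)) = 0
      \<longleftrightarrow> (AE t in lborel. f t * f t * exp (- \<beta> * t\<^sup>2) = 0)"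
    by (intro integral_nonneg_eq_0_iff_AE) auto
  with 1 show ?case by (auto simp: ae_eq_def)
qed

lemma L2_Cauchy_Schwarz:
  assumes "f \<in> L2 \<beta>" "g \<in> L2 \<beta>"
  shows "\<bar>L2_inner \<beta> f g\<bar> \<le> L2_norm \<beta> f * L2_norm \<beta> g"
proof -
  let ?a = "L2_inner \<beta> f f" and ?b = "L2_inner \<beta> f g" and ?c = "L2_inner \<beta> g g"
  have nn: "0 \<le> ?a + 2 * r * ?b + r\<^sup>2 * ?c" for r
    using L2_inner_nonneg[of \<beta> "f + r *\<^sub>R g"] L2_inner_add_scaleR_self[OF assms] by simp
  have "?b\<^sup>2 \<le> ?a * ?c"
  proof (cases "?c = 0")
    case True
    then have "g = 0" using assms L2_inner_eq_zero_iff by blast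
    moreover have "L2_inner \<beta> f 0 = 0" by transfer simp
    ultimately show ?thesis using True by simp
  next
    case False
    then have "0 < ?c" using L2_inner_nonneg[of \<beta> g] by simp
    then show ?thesis
      using nn[of "- ?b / ?c"] by (simp add: field_simps power2_eq_square)
  qed
  then have "sqrt (?b\<^sup>2) \<le> sqrt (?a * ?c)" by (rule real_sqrt_le_mono)
  then show ?thesis by (simp add: L2_norm_def real_sqrt_mult)
qed

lemma L2_norm_triangle:
  assumes "f \<in> L2 \<beta>" "g \<in> L2 \<beta>"
  shows "L2_norm \<beta> (f + g) \<le> L2_norm \<beta> f + L2_norm \<beta> g"
proof (rule power2_le_imp_le)
  have "L2_inner \<beta> (f + g) (f + g) = L2_inner \<beta> f f + 2 * L2_inner \<beta> f g + L2_inner \<beta> g g"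
    using L2_inner_add_scaleR_self[OF assms, of 1] by simp
  then show "(L2_norm \<beta> (f + g))\<^sup>2 \<le> (L2_norm \<beta> f + L2_norm \<beta> g)\<^sup>2"
    using L2_Cauchy_Schwarz[OF assms] L2_norm_power2[of \<beta>]
    by (simp add: power2_sum)
qed (simp add: L2_norm_def L2_inner_nonneg)

lemma Metric_space_L2: "Metric_space (L2 \<beta>) (L2_dist \<beta>)"
proof
  fix f g h
  show "0 \<le> L2_dist \<beta> f g" by (simp add: L2_dist_def L2_norm_def L2_inner_nonneg)
  have "L2_inner \<beta> (f - g) (f - g) = L2_inner \<beta> (g - f) (g - f)"
    by transfer (simp add: algebra_simps)
  then show "L2_dist \<beta> f g = L2_dist \<beta> g f" by (simp add: L2_dist_def L2_norm_def)
  assume f: "f \<in> L2 \<beta>" and g: "g \<in> L2 \<beta>"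
  then show "L2_dist \<beta> f g = 0 \<longleftrightarrow> f = g"
    by (simp add: L2_dist_def L2_norm_def L2_inner_eq_zero_iff L2_diff)
  assume h: "h \<in> L2 \<beta>"
  show "L2_dist \<beta> f h \<le> L2_dist \<beta> f g + L2_dist \<beta> g h"
    using L2_norm_triangle[OF L2_diff[OF f g] L2_diff[OF g h]] by (simp add: L2_dist_def)
qed

definition L2_borel :: "real \<Rightarrow> ae_fun measure" where
  "L2_borel \<beta> = sigma (L2 \<beta>) {U. openin (Metric_space.mtopology (L2 \<beta>) (L2_dist \<beta>)) U}"

text \<open>The degenerate case is the point mass at \<open>0\<close>, which has no density.\<close>

definition centred_normal :: "'a measure \<Rightarrow> ('a \<Rightarrow> real) \<Rightarrow> bool" where
  "centred_normal M X \<longleftrightarrow> X \<in> borel_measurable M \<and>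
     ((AE \<omega> in M. X \<omega> = 0) \<or> (\<exists>\<sigma>>0. distributed M lborel X (normal_density 0 \<sigma>)))"

text \<open>
  The double integral need not respect equality almost everywhere for a non-measurable \<open>K\<close>, so
  it is stated for all representatives \<open>f\<close>, \<open>g\<close> rather than lifted to classes.
\<close>

definition gaussian_element ::
    "real \<Rightarrow> 'a measure \<Rightarrow> ('a \<Rightarrow> ae_fun) \<Rightarrow> (real \<Rightarrow> real \<Rightarrow> real) \<Rightarrow> bool" where
  "gaussian_element \<beta> M W K \<longleftrightarrow>
     W \<in> measurable M (L2_borel \<beta>) \<and>
     (\<forall>f\<in>L2 \<beta>. centred_normal M (\<lambda>\<omega>. L2_inner \<beta> (W \<omega>) f)) \<and>
     (\<forall>f\<in>borel_measurable borel. \<forall>g\<in>borel_measurable borel.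
        ae_class f \<in> L2 \<beta> \<longrightarrow> ae_class g \<in> L2 \<beta> \<longrightarrow>
        (LINT \<omega>|M. L2_inner \<beta> (W \<omega>) (ae_class f) * L2_inner \<beta> (W \<omega>) (ae_class g)) =
        (LINT t|lborel. LINT s|lborel.
           K s t * f s * g t * exp (- \<beta> * s\<^sup>2) * exp (- \<beta> * t\<^sup>2)))"

definition limit_kernel :: "real \<Rightarrow> real \<Rightarrow> real" where
  "limit_kernel s t =
     exp ((t\<^sup>2 + s\<^sup>2) / 2) * (exp (t * s) - 1 - t * s - t\<^sup>2 * s\<^sup>2 / 2)"

end

theory Submission
  imports Defs
begin

text \<open>
  Gram--Schmidt on the indicators of rational half-lines gives a system \<open>e\<^sub>i\<close> with Parseval's
  identity, so \<open>T = (\<Sum>i. X\<^sub>i\<^sup>2)\<close> for the jointly normal coordinates \<open>X\<^sub>i = \<langle>W, e\<^sub>i\<rangle>\<close>. With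
  \<open>\<sigma>\<^sub>i\<^sub>j = E (X\<^sub>i X\<^sub>j)\<close>, Isserlis' formula \<open>E (X\<^sub>i\<^sup>2 X\<^sub>j\<^sup>2) = \<sigma>\<^sub>i\<^sub>i \<sigma>\<^sub>j\<^sub>j + 2 \<sigma>\<^sub>i\<^sub>j\<^sup>2\<close> yields
  \<open>E T = (\<Sum>i. \<sigma>\<^sub>i\<^sub>i)\<close> and \<open>V T = 2 (\<Sum>i j. \<sigma>\<^sub>i\<^sub>j\<^sup>2)\<close>. Parseval in both variables turns the latter sum
  into the integral of \<open>K\<^sup>2\<close>; the trace is the integral of \<open>K(t,t)\<close>, by the expansion of \<open>K\<close> coming
  from the exponential series. Both are Gaussian integrals.
\<close>

section \<open>Gram--Schmidt in the weighted space\<close>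

text \<open>A Gaussian element is known only through the scalars <W, f>. Its values are classes, so
  W(t) has no meaning at a single point, and expectation cannot simply be exchanged with the
  integral of W(t)^2. The squared norm is therefore reached through countably many scalars, with
  Parseval's identity available for every vector and hence at each \<omega> separately. Joint
  normality enters only through X_i + X_j and X_i - X_j, which are scalars of the same form. The two
  series of covariances differ in nature. The sum of squares sees the kernel only up to null sets.
  The trace does not: the diagonal is itself a null set, and only the pointwise expansion of K into
  products phi_k(s) phi_k(t) ties the trace to K(t,t). The condition \<beta> > 2 comes from the
  bound |K(s,t)| <= e^(s^2) e^(t^2): the factor e^(t^2) is square integrable for the weight exactly
  for these \<beta>.\<close>

lemma zero_in_L2 [simp]: "0 \<in> L2 \<beta>"
  unfolding L2_def mem_Collect_eq by transfer simp

lemma L2_add: "f \<in> L2 \<beta> \<Longrightarrow> g \<in> L2 \<beta> \<Longrightarrow> f + g \<in> L2 \<beta>"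
  using L2_add_scaleR[of f \<beta> g 1] by simp

lemma L2_scaleR: "f \<in> L2 \<beta> \<Longrightarrow> c *\<^sub>R f \<in> L2 \<beta>"
  using L2_add_scaleR[of 0 \<beta> f c] by simp

lemma L2_sum: "(\<And>i. i \<in> I \<Longrightarrow> f i \<in> L2 \<beta>) \<Longrightarrow> sum f I \<in> L2 \<beta>"
  by (induction I rule: infinite_finite_induct) (auto intro: L2_add)

lemma L2_inner_zero [simp]: "L2_inner \<beta> 0 f = 0" "L2_inner \<beta> f 0 = 0"
  by (transfer; simp)+

lemma L2_inner_add_left:
  "f \<in> L2 \<beta> \<Longrightarrow> g \<in> L2 \<beta> \<Longrightarrow> h \<in> L2 \<beta> \<Longrightarrow> L2_inner \<beta> (f + g) h = L2_inner \<beta> f h + L2_inner \<beta> g h"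
  using L2_inner_add_scaleR_left[of f \<beta> g h 1] by simp

lemma L2_inner_scaleR_left:
  "f \<in> L2 \<beta> \<Longrightarrow> h \<in> L2 \<beta> \<Longrightarrow> L2_inner \<beta> (c *\<^sub>R f) h = c * L2_inner \<beta> f h"
  using L2_inner_add_scaleR_left[of 0 \<beta> f h c] by simp

lemma L2_inner_diff_left:
  "f \<in> L2 \<beta> \<Longrightarrow> g \<in> L2 \<beta> \<Longrightarrow> h \<in> L2 \<beta> \<Longrightarrow> L2_inner \<beta> (f - g) h = L2_inner \<beta> f h - L2_inner \<beta> g h"
  using L2_inner_add_scaleR_left[of f \<beta> g h "-1"] by simp

lemma L2_inner_sum_left:
  "(\<And>i. i \<in> I \<Longrightarrow> f i \<in> L2 \<beta>) \<Longrightarrow> h \<in> L2 \<beta> \<Longrightarrow> L2_inner \<beta> (sum f I) h = (\<Sum>i\<in>I. L2_inner \<beta> (f i) h)"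
  by (induction I rule: infinite_finite_induct) (auto simp: L2_inner_add_left L2_sum)

lemma L2_norm_scaleR: "f \<in> L2 \<beta> \<Longrightarrow> L2_norm \<beta> (c *\<^sub>R f) = \<bar>c\<bar> * L2_norm \<beta> f"
  by (simp add: L2_norm_def L2_inner_scaleR_left L2_scaleR
      L2_inner_commute[of \<beta> f "c *\<^sub>R f"] mult.assoc[symmetric] real_sqrt_mult)

lemma L2_norm_nonneg: "0 \<le> L2_norm \<beta> f"
  by (simp add: L2_norm_def L2_inner_nonneg)

fun gram_schmidt :: "real \<Rightarrow> (nat \<Rightarrow> ae_fun) \<Rightarrow> nat \<Rightarrow> ae_fun" where
  "gram_schmidt \<beta> v n =
    (let u = v n - (\<Sum>i<n. L2_inner \<beta> (v n) (gram_schmidt \<beta> v i) *\<^sub>R gram_schmidt \<beta> v i)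
     in (1 / L2_norm \<beta> u) *\<^sub>R u)"

declare gram_schmidt.simps [simp del]

definition proj_upto :: "real \<Rightarrow> (nat \<Rightarrow> ae_fun) \<Rightarrow> nat \<Rightarrow> ae_fun \<Rightarrow> ae_fun" where
  "proj_upto \<beta> e n f = (\<Sum>i<n. L2_inner \<beta> f (e i) *\<^sub>R e i)"

lemma gram_schmidt_eq:
  "gram_schmidt \<beta> v n = (1 / L2_norm \<beta> (v n - proj_upto \<beta> (gram_schmidt \<beta> v) n (v n)))
     *\<^sub>R (v n - proj_upto \<beta> (gram_schmidt \<beta> v) n (v n))"
  by (subst gram_schmidt.simps) (simp add: proj_upto_def Let_def)

lemma proj_upto_in_L2: "(\<And>i. i < n \<Longrightarrow> e i \<in> L2 \<beta>) \<Longrightarrow> proj_upto \<beta> e n f \<in> L2 \<beta>"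
  unfolding proj_upto_def by (intro L2_sum L2_scaleR) auto

lemma gram_schmidt_in_L2:
  assumes "\<And>n. v n \<in> L2 \<beta>"
  shows "gram_schmidt \<beta> v n \<in> L2 \<beta>"
proof (induction n rule: less_induct)
  case (less n)
  then show ?case
    by (subst gram_schmidt_eq) (intro L2_scaleR L2_diff assms proj_upto_in_L2)
qed

text \<open>Vectors that depend on their predecessors become \<open>0\<close>, because \<open>1 / 0 = 0\<close>; so the system is
  orthonormal up to zero vectors.\<close>

definition orthonormal_or_zero :: "real \<Rightarrow> (nat \<Rightarrow> ae_fun) \<Rightarrow> bool" where
  "orthonormal_or_zero \<beta> e \<longleftrightarrow> (\<forall>i. e i \<in> L2 \<beta>) \<and>
     (\<forall>i j. i \<noteq> j \<longrightarrow> L2_inner \<beta> (e i) (e j) = 0) \<and> (\<forall>i. e i = 0 \<or> L2_inner \<beta> (e i) (e i) = 1)"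

lemma proj_upto_inner:
  assumes "\<And>i. i < n \<Longrightarrow> e i \<in> L2 \<beta>" "h \<in> L2 \<beta>"
  shows "L2_inner \<beta> (proj_upto \<beta> e n f) h = (\<Sum>i<n. L2_inner \<beta> f (e i) * L2_inner \<beta> (e i) h)"
proof -
  have "L2_inner \<beta> (proj_upto \<beta> e n f) h = (\<Sum>i<n. L2_inner \<beta> (L2_inner \<beta> f (e i) *\<^sub>R e i) h)"
    unfolding proj_upto_def using assms by (intro L2_inner_sum_left L2_scaleR) auto
  also have "\<dots> = (\<Sum>i<n. L2_inner \<beta> f (e i) * L2_inner \<beta> (e i) h)"
    using assms by (intro sum.cong) (auto simp: L2_inner_scaleR_left)
  finally show ?thesis .
qed

text \<open>Each vector is a multiple of the residual \<open>u n\<close>, which is orthogonal to all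
  predecessors by strong induction. Symmetry of the inner product then covers both orders of a pair
  of indices.\<close>

lemma orthonormal_or_zero_gram_schmidt:
  assumes v: "\<And>n. v n \<in> L2 \<beta>"
  shows "orthonormal_or_zero \<beta> (gram_schmidt \<beta> v)"
proof -
  let ?e = "gram_schmidt \<beta> v"
  define u where "u n = v n - proj_upto \<beta> ?e n (v n)" for n
  have e: "?e n \<in> L2 \<beta>" for n
    using gram_schmidt_in_L2[OF v] .
  have u: "u n \<in> L2 \<beta>" for n
    unfolding u_def by (intro L2_diff v proj_upto_in_L2 e)
  have eu: "?e n = (1 / L2_norm \<beta> (u n)) *\<^sub>R u n" for n
    unfolding u_def by (rule gram_schmidt_eq)
  have unit: "?e n = 0 \<or> L2_inner \<beta> (?e n) (?e n) = 1" for n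
  proof (cases "u n = 0")
    case True
    then show ?thesis by (simp add: eu)
  next
    case False
    then have "L2_norm \<beta> (u n) \<noteq> 0"
      using L2_inner_eq_zero_iff[OF u] by (simp add: L2_norm_def)
    moreover have "(L2_norm \<beta> (?e n)) = \<bar>1 / L2_norm \<beta> (u n)\<bar> * L2_norm \<beta> (u n)"
      by (subst eu, rule L2_norm_scaleR[OF u])
    ultimately have "L2_norm \<beta> (?e n) = 1"
      using L2_norm_nonneg[of \<beta> "u n"] by simp
    then show ?thesis using L2_norm_power2[of \<beta> "?e n"] by simp
  qed
  have orth: "\<forall>j<n. L2_inner \<beta> (?e n) (?e j) = 0" for n
  proof (induction n rule: less_induct)
    case (less n)
    show ?case
    proof (intro allI impI)
      fix j assume j: "j < n"
      have "L2_inner \<beta> (u n) (?e j) = L2_inner \<beta> (v n) (?e j) -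
          (\<Sum>i<n. L2_inner \<beta> (v n) (?e i) * L2_inner \<beta> (?e i) (?e j))"
        unfolding u_def by (simp add: L2_inner_diff_left v e proj_upto_in_L2 proj_upto_inner)
      also have "(\<Sum>i<n. L2_inner \<beta> (v n) (?e i) * L2_inner \<beta> (?e i) (?e j))
        = (\<Sum>i\<in>{j}. L2_inner \<beta> (v n) (?e i) * L2_inner \<beta> (?e i) (?e j))"
      proof (rule sum.mono_neutral_right)
        show "\<forall>i\<in>{..<n} - {j}. L2_inner \<beta> (v n) (?e i) * L2_inner \<beta> (?e i) (?e j) = 0"
        proof
          fix i assume i: "i \<in> {..<n} - {j}"
          then have "L2_inner \<beta> (?e i) (?e j) = 0"
            using less.IH[of i] less.IH[of j] j
            by (cases "i < j") (auto simp: L2_inner_commute[of \<beta> "?e i"])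
          then show "L2_inner \<beta> (v n) (?e i) * L2_inner \<beta> (?e i) (?e j) = 0" by simp
        qed
      qed (use j in auto)
      \<comment> \<open>If \<open>?e j\<close> is zero, both terms vanish; otherwise its square norm
        is 1 and they cancel.\<close>
      also have "L2_inner \<beta> (v n) (?e j) - \<dots> = 0"
        using unit[of j] by auto
      finally show "L2_inner \<beta> (?e n) (?e j) = 0"
        by (simp add: eu[of n] L2_inner_scaleR_left u e)
    qed
  qed
  have "L2_inner \<beta> (?e i) (?e j) = 0" if "i \<noteq> j" for i j
    using orth[of i] orth[of j] that
    by (cases "i < j") (auto simp: L2_inner_commute[of \<beta> "?e i"])
  then show ?thesis
    using e unit by (auto simp: orthonormal_or_zero_def)
qed

text \<open>Pythagoras: the projection is orthogonal to the residual, and its squared norm is the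
  sum of the squared coefficients. For the same reason the inner product of the residual with
  \<open>f\<close> equals its own squared norm. This second form evaluates the newest coefficient in
  \<open>gram_schmidt_expandable\<close>.\<close>

lemma proj_upto_residual:
  assumes e: "orthonormal_or_zero \<beta> e" and f: "f \<in> L2 \<beta>"
  shows "(L2_norm \<beta> (f - proj_upto \<beta> e n f))\<^sup>2
    = L2_inner \<beta> f f - (\<Sum>i<n. (L2_inner \<beta> f (e i))\<^sup>2)"
    and "L2_inner \<beta> (f - proj_upto \<beta> e n f) f = L2_inner \<beta> f f - (\<Sum>i<n. (L2_inner \<beta> f (e i))\<^sup>2)"
proof -
  let ?p = "proj_upto \<beta> e n f"
  have eL [simp]: "e i \<in> L2 \<beta>" for i
    using e by (simp add: orthonormal_or_zero_def)
  have p [simp]: "?p \<in> L2 \<beta>" by (intro proj_upto_in_L2 eL)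
  have pf: "L2_inner \<beta> ?p f = (\<Sum>i<n. (L2_inner \<beta> f (e i))\<^sup>2)"
    unfolding proj_upto_inner[OF eL f] power2_eq_square
    by (intro sum.cong refl) (metis L2_inner_commute)
  have pe: "L2_inner \<beta> ?p (e j) = L2_inner \<beta> f (e j)" if "j < n" for j
  proof -
    have "L2_inner \<beta> ?p (e j) = (\<Sum>i<n. L2_inner \<beta> f (e i) * L2_inner \<beta> (e i) (e j))"
      by (simp add: proj_upto_inner)
    also have "\<dots> = (\<Sum>i\<in>{j}. L2_inner \<beta> f (e i) * L2_inner \<beta> (e i) (e j))"
      using e that by (intro sum.mono_neutral_right) (auto simp: orthonormal_or_zero_def)
    \<comment> \<open>For a zero vector \<open>e j\<close> both sides are 0.\<close>
    also have "\<dots> = L2_inner \<beta> f (e j)"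
      using e by (auto simp: orthonormal_or_zero_def) (metis L2_inner_zero(2))
    finally show ?thesis .
  qed
  have pp: "L2_inner \<beta> ?p ?p = (\<Sum>i<n. (L2_inner \<beta> f (e i))\<^sup>2)"
  proof -
    have "L2_inner \<beta> ?p ?p = (\<Sum>i<n. L2_inner \<beta> f (e i) * L2_inner \<beta> (e i) ?p)"
      by (simp add: proj_upto_inner[where h = ?p])
    also have "\<dots> = (\<Sum>i<n. (L2_inner \<beta> f (e i))\<^sup>2)"
      by (intro sum.cong) (auto simp: L2_inner_commute[of \<beta> _ ?p] pe power2_eq_square)
    finally show ?thesis .
  qed
  show 1: "L2_inner \<beta> (f - ?p) f = L2_inner \<beta> f f - (\<Sum>i<n. (L2_inner \<beta> f (e i))\<^sup>2)"
    by (simp add: L2_inner_diff_left f pf)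
  have "L2_inner \<beta> (f - ?p) (f - ?p) = L2_inner \<beta> f (f - ?p) - L2_inner \<beta> ?p (f - ?p)"
    by (intro L2_inner_diff_left f p L2_diff)
  then have "L2_inner \<beta> (f - ?p) (f - ?p) = L2_inner \<beta> (f - ?p) f - L2_inner \<beta> (f - ?p) ?p"
    by (metis L2_inner_commute)
  also have "L2_inner \<beta> (f - ?p) ?p = 0"
    by (simp add: L2_inner_diff_left f pp L2_inner_commute[of \<beta> f ?p] pf)
  finally show "(L2_norm \<beta> (f - ?p))\<^sup>2 = L2_inner \<beta> f f - (\<Sum>i<n. (L2_inner \<beta> f (e i))\<^sup>2)"
    by (simp add: L2_norm_power2 1)
qed

text \<open>This plays the role of the closed linear span of \<open>e\<close>. Stated through
  residuals, closure under linear combinations and limits is immediate, which is what the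
  approximation of arbitrary functions by indicators needs.\<close>

definition expandable :: "real \<Rightarrow> (nat \<Rightarrow> ae_fun) \<Rightarrow> ae_fun set" where
  "expandable \<beta> e = {f \<in> L2 \<beta>. (\<lambda>n. L2_norm \<beta> (f - proj_upto \<beta> e n f)) \<longlonglongrightarrow> 0}"

lemma expandable_sums:
  assumes "orthonormal_or_zero \<beta> e" "f \<in> expandable \<beta> e"
  shows "(\<lambda>i. (L2_inner \<beta> f (e i))\<^sup>2) sums L2_inner \<beta> f f"
proof -
  have f: "f \<in> L2 \<beta>" and *: "(\<lambda>n. L2_norm \<beta> (f - proj_upto \<beta> e n f)) \<longlonglongrightarrow> 0"
    using assms by (auto simp: expandable_def)
  have "(\<lambda>n. L2_inner \<beta> f f - (L2_norm \<beta> (f - proj_upto \<beta> e n f))\<^sup>2) \<longlonglongrightarrow> L2_inner \<beta> f f - 0\<^sup>2"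
    by (intro tendsto_intros *)
  then show ?thesis
    by (simp add: sums_def proj_upto_residual(1)[OF assms(1) f])
qed

text \<open>The residual \<open>u\<close> of \<open>v k\<close> after \<open>k\<close> projections
  is its norm times \<open>gram_schmidt \<beta> v k\<close>, so the next coefficient exhausts it.
  From \<open>Suc k\<close> on the residual is exactly 0.\<close>

lemma gram_schmidt_expandable:
  assumes v: "\<And>n. v n \<in> L2 \<beta>"
  shows "v k \<in> expandable \<beta> (gram_schmidt \<beta> v)"
proof -
  let ?e = "gram_schmidt \<beta> v"
  note on = orthonormal_or_zero_gram_schmidt[OF v]
  define u where "u = v k - proj_upto \<beta> ?e k (v k)"
  have eL: "?e i \<in> L2 \<beta>" for i by (rule gram_schmidt_in_L2[OF v])
  have uL: "u \<in> L2 \<beta>" unfolding u_def by (intro L2_diff v proj_upto_in_L2 eL)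
  have eu: "?e k = (1 / L2_norm \<beta> u) *\<^sub>R u"
    unfolding u_def by (rule gram_schmidt_eq)
  have "L2_inner \<beta> (v k) (?e k) = L2_inner \<beta> u (v k) / L2_norm \<beta> u"
    by (simp add: L2_inner_commute[of \<beta> "v k"] eu L2_inner_scaleR_left uL v)
  also have "L2_inner \<beta> u (v k) = (L2_norm \<beta> u)\<^sup>2"
    unfolding u_def by (simp add: proj_upto_residual[OF on v])
  \<comment> \<open>This also covers a residual of norm 0, where the quotient is 0 / 0 = 0.\<close>
  finally have "(L2_inner \<beta> (v k) (?e k))\<^sup>2 = (L2_norm \<beta> u)\<^sup>2"
    by (simp add: power2_eq_square)
  then have full: "(\<Sum>i<Suc k. (L2_inner \<beta> (v k) (?e i))\<^sup>2) = L2_inner \<beta> (v k) (v k)"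
    unfolding u_def by (simp add: proj_upto_residual(1)[OF on v])
  have "L2_norm \<beta> (v k - proj_upto \<beta> ?e n (v k)) = 0" if "n \<ge> Suc k" for n
  proof -
    have "(\<Sum>i<Suc k. (L2_inner \<beta> (v k) (?e i))\<^sup>2) \<le> (\<Sum>i<n. (L2_inner \<beta> (v k) (?e i))\<^sup>2)"
      using that by (intro sum_mono2) auto
    then have "(L2_norm \<beta> (v k - proj_upto \<beta> ?e n (v k)))\<^sup>2 \<le> 0"
      using full by (simp add: proj_upto_residual(1)[OF on v])
    then show ?thesis by simp
  qed
  then have "\<forall>\<^sub>F n in sequentially. L2_norm \<beta> (v k - proj_upto \<beta> ?e n (v k)) = 0"
    unfolding eventually_sequentially by blast
  then show ?thesis
    using v by (auto simp: expandable_def intro: tendsto_eventually)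
qed

lemma proj_upto_add_scaleR:
  assumes "\<And>i. e i \<in> L2 \<beta>" "f \<in> L2 \<beta>" "g \<in> L2 \<beta>"
  shows "proj_upto \<beta> e n (f + c *\<^sub>R g) = proj_upto \<beta> e n f + c *\<^sub>R proj_upto \<beta> e n g"
  using assms
  by (simp add: proj_upto_def L2_inner_add_scaleR_left scaleR_left_distrib sum.distrib scaleR_sum_right)

lemma residual_add_scaleR_le:
  assumes e: "\<And>i. e i \<in> L2 \<beta>" and f: "f \<in> L2 \<beta>" and g: "g \<in> L2 \<beta>"
  shows "L2_norm \<beta> ((f + c *\<^sub>R g) - proj_upto \<beta> e n (f + c *\<^sub>R g))
    \<le> L2_norm \<beta> (f - proj_upto \<beta> e n f) + \<bar>c\<bar> * L2_norm \<beta> (g - proj_upto \<beta> e n g)"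
proof -
  have eq: "(f + c *\<^sub>R g) - proj_upto \<beta> e n (f + c *\<^sub>R g)
    = (f - proj_upto \<beta> e n f) + c *\<^sub>R (g - proj_upto \<beta> e n g)"
    by (simp add: proj_upto_add_scaleR assms scaleR_diff_right)
  have "f - proj_upto \<beta> e n f \<in> L2 \<beta>" "g - proj_upto \<beta> e n g \<in> L2 \<beta>"
    by (intro L2_diff f g proj_upto_in_L2 e)+
  then show ?thesis
    unfolding eq
    using L2_norm_triangle[of "f - proj_upto \<beta> e n f" \<beta> "c *\<^sub>R (g - proj_upto \<beta> e n g)"]
    by (simp add: L2_scaleR L2_norm_scaleR)
qed

lemma expandable_add_scaleR:
  assumes e: "\<And>i. e i \<in> L2 \<beta>" and "f \<in> expandable \<beta> e" "g \<in> expandable \<beta> e"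
  shows "f + c *\<^sub>R g \<in> expandable \<beta> e"
proof -
  have f: "f \<in> L2 \<beta>" "(\<lambda>n. L2_norm \<beta> (f - proj_upto \<beta> e n f)) \<longlonglongrightarrow> 0"
    and g: "g \<in> L2 \<beta>" "(\<lambda>n. L2_norm \<beta> (g - proj_upto \<beta> e n g)) \<longlonglongrightarrow> 0"
    using assms by (auto simp: expandable_def)
  have "(\<lambda>n. L2_norm \<beta> (f - proj_upto \<beta> e n f) + \<bar>c\<bar> * L2_norm \<beta> (g - proj_upto \<beta> e n g)) \<longlonglongrightarrow> 0 + \<bar>c\<bar> * 0"
    by (intro tendsto_intros f g)
  then have lim: "(\<lambda>n. L2_norm \<beta> (f - proj_upto \<beta> e n f) + \<bar>c\<bar> * L2_norm \<beta> (g - proj_upto \<beta> e n g)) \<longlonglongrightarrow> 0"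
    by simp
  have "(\<lambda>n. L2_norm \<beta> ((f + c *\<^sub>R g) - proj_upto \<beta> e n (f + c *\<^sub>R g))) \<longlonglongrightarrow> 0"
    by (rule tendsto_sandwich[OF _ _ tendsto_const lim])
      (auto intro!: always_eventually L2_norm_nonneg residual_add_scaleR_le e f g)
  then show ?thesis
    using f g by (auto simp: expandable_def L2_add_scaleR)
qed

text \<open>By Bessel's inequality, taking residuals does not increase the norm. So the residual of
  \<open>f\<close> is at most the distance from \<open>f\<close> to \<open>g k\<close> plus the
  residual of \<open>g k\<close>, and each can be made smaller than half of any tolerance.\<close>

lemma expandable_limit:
  assumes e: "orthonormal_or_zero \<beta> e" and g: "\<And>k. g k \<in> expandable \<beta> e" and f: "f \<in> L2 \<beta>"
    and lim: "(\<lambda>k. L2_norm \<beta> (f - g k)) \<longlonglongrightarrow> 0"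
  shows "f \<in> expandable \<beta> e"
proof -
  have eL: "e i \<in> L2 \<beta>" for i using e by (simp add: orthonormal_or_zero_def)
  have gL: "g k \<in> L2 \<beta>" for k using g by (auto simp: expandable_def)
  have le: "L2_norm \<beta> (f - proj_upto \<beta> e n f) \<le> L2_norm \<beta> (f - g k) + L2_norm \<beta> (g k - proj_upto \<beta> e n (g k))" for n k
  proof -
    have d: "f - g k \<in> L2 \<beta>" by (intro L2_diff f gL)
    have "(L2_norm \<beta> ((f - g k) - proj_upto \<beta> e n (f - g k)))\<^sup>2 \<le> (L2_norm \<beta> (f - g k))\<^sup>2"
      using proj_upto_residual(1)[OF e d, of n] L2_norm_power2[of \<beta> "f - g k"]
        sum_nonneg[of "{..<n}" "\<lambda>i. (L2_inner \<beta> (f - g k) (e i))\<^sup>2", OF zero_le_power2]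
      by linarith
    then have "L2_norm \<beta> ((f - g k) - proj_upto \<beta> e n (f - g k)) \<le> L2_norm \<beta> (f - g k)"
      by (rule power2_le_imp_le) (rule L2_norm_nonneg)
    moreover have "L2_norm \<beta> (((f - g k) + 1 *\<^sub>R g k) - proj_upto \<beta> e n ((f - g k) + 1 *\<^sub>R g k))
      \<le> L2_norm \<beta> ((f - g k) - proj_upto \<beta> e n (f - g k)) + \<bar>1\<bar> * L2_norm \<beta> (g k - proj_upto \<beta> e n (g k))"
      by (rule residual_add_scaleR_le[OF eL d gL])
    ultimately show ?thesis by simp
  qed
  have "(\<lambda>n. L2_norm \<beta> (f - proj_upto \<beta> e n f)) \<longlonglongrightarrow> 0"
  proof (rule LIMSEQ_I)
    fix r :: real assume r: "0 < r"
    obtain k where k: "L2_norm \<beta> (f - g k) < r / 2"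
      using LIMSEQ_D[OF lim, of "r/2"] r L2_norm_nonneg by (auto simp: abs_of_nonneg)
    have "(\<lambda>n. L2_norm \<beta> (g k - proj_upto \<beta> e n (g k))) \<longlonglongrightarrow> 0"
      using g[of k] by (simp add: expandable_def)
    then obtain N where "\<And>n. n \<ge> N \<Longrightarrow> L2_norm \<beta> (g k - proj_upto \<beta> e n (g k)) < r / 2"
      using LIMSEQ_D[of "\<lambda>n. L2_norm \<beta> (g k - proj_upto \<beta> e n (g k))" 0 "r/2"] r L2_norm_nonneg
      by (auto simp: abs_of_nonneg)
    then have "norm (L2_norm \<beta> (f - proj_upto \<beta> e n f) - 0) < r" if "n \<ge> N" for n
      using le[of n k] k that L2_norm_nonneg[of \<beta> "f - proj_upto \<beta> e n f"] by fastforce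
    then show "\<exists>no. \<forall>n\<ge>no. norm (L2_norm \<beta> (f - proj_upto \<beta> e n f) - 0) < r" by blast
  qed
  then show ?thesis using f by (simp add: expandable_def)
qed

section \<open>A countable Parseval system\<close>

lemma has_bochner_integral_gaussian_even:
  assumes a: "0 < (a::real)"
  shows "has_bochner_integral lborel (\<lambda>t. t ^ (2 * k) * exp (- a * t\<^sup>2))
    (fact (2 * k) / ((4 * a) ^ k * fact k) * sqrt (pi / a))"
proof -
  \<comment> \<open>With variance 1 / (2a), the normal density is e^(-a t^2) divided by sqrt (pi /
    a), so its moments only have to be rescaled.\<close>
  define \<sigma> where "\<sigma> = 1 / sqrt (2 * a)"
  have s: "\<sigma> > 0" "\<sigma>\<^sup>2 = 1 / (2 * a)" using a by (auto simp: \<sigma>_def power_divide)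
  have d: "normal_density 0 \<sigma> t = sqrt (a / pi) * exp (- a * t\<^sup>2)" for t
    using a by (simp add: normal_density_def s real_sqrt_divide field_simps)
  have "has_bochner_integral lborel (\<lambda>t. sqrt (pi / a) * (normal_density 0 \<sigma> t * (t - 0) ^ (2 * k)))
     (sqrt (pi / a) * (fact (2 * k) / ((2 / \<sigma>\<^sup>2) ^ k * fact k)))"
    by (intro has_bochner_integral_mult_right normal_moment_even s)
  note hb = this
  have "sqrt (pi / a) * sqrt (a / pi) = 1"
    using a by (simp add: real_sqrt_mult[symmetric])
  then have eq: "sqrt (pi / a) * (normal_density 0 \<sigma> t * (t - 0) ^ (2 * k)) = t ^ (2 * k) * exp (- a * t\<^sup>2)" for t
    by (simp add: d mult.assoc[symmetric])
  show ?thesis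
    using hb a unfolding eq by (simp add: s mult.commute)
qed

lemma has_bochner_integral_gaussian_odd:
  assumes a: "0 < (a::real)"
  shows "has_bochner_integral lborel (\<lambda>t. t ^ (2 * k + 1) * exp (- a * t\<^sup>2)) 0"
proof -
  define \<sigma> where "\<sigma> = 1 / sqrt (2 * a)"
  have s: "\<sigma> > 0" "\<sigma>\<^sup>2 = 1 / (2 * a)" using a by (auto simp: \<sigma>_def power_divide)
  have d: "normal_density 0 \<sigma> t = sqrt (a / pi) * exp (- a * t\<^sup>2)" for t
    using a by (simp add: normal_density_def s real_sqrt_divide field_simps)
  have "has_bochner_integral lborel (\<lambda>t. sqrt (pi / a) * (normal_density 0 \<sigma> t * (t - 0) ^ (2 * k + 1)))
     (sqrt (pi / a) * 0)"
    by (intro has_bochner_integral_mult_right normal_moment_odd s)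
  note hb = this
  have "sqrt (pi / a) * sqrt (a / pi) = 1"
    using a by (simp add: real_sqrt_mult[symmetric])
  then have eq: "sqrt (pi / a) * (normal_density 0 \<sigma> t * (t - 0) ^ (2 * k + 1)) = t ^ (2 * k + 1) * exp (- a * t\<^sup>2)" for t
    by (simp add: d mult.assoc[symmetric])
  show ?thesis
    using hb unfolding eq by simp
qed

lemma integrable_gaussian_moment:
  "0 < (a::real) \<Longrightarrow> integrable lborel (\<lambda>t. t ^ n * exp (- a * t\<^sup>2))"
  using has_bochner_integral_gaussian_even[of a "n div 2"] has_bochner_integral_gaussian_odd[of a "n div 2"]
  by (cases "even n") (auto dest: integrable.intros)

lemma integrable_gaussian: "0 < (a::real) \<Longrightarrow> integrable lborel (\<lambda>t. exp (- a * t\<^sup>2))"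
  using integrable_gaussian_moment[of a 0] by simp

section \<open>Measurable representatives and approximation by indicators\<close>

lemma ae_fun_cases:
  obtains f where "f \<in> borel_measurable borel" "F = ae_class f"
proof
  have "ae_eq (rep_ae_fun F) (rep_ae_fun F)"
    using Quotient_rep_reflp[OF Quotient_ae_fun] .
  then show "rep_ae_fun F \<in> borel_measurable borel" by (simp add: ae_eq_def)
  show "F = ae_class (rep_ae_fun F)"
    using Quotient_abs_rep[OF Quotient_ae_fun] by simp
qed

lemma ae_class_add_scaleR:
  assumes "f \<in> borel_measurable borel" "g \<in> borel_measurable borel"
  shows "ae_class f + c *\<^sub>R ae_class g = ae_class (\<lambda>t. f t + c * g t)"
proof -
  have "ae_eq f f" "ae_eq g g" "ae_eq (\<lambda>t. c * g t) (\<lambda>t. c * g t)"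
    using assms by (auto simp: ae_eq_def)
  then show ?thesis by (simp add: plus_ae_fun.abs_eq scaleR_ae_fun.abs_eq)
qed

lemma ae_class_diff:
  assumes "f \<in> borel_measurable borel" "g \<in> borel_measurable borel"
  shows "ae_class f - ae_class g = ae_class (\<lambda>t. f t - g t)"
  using ae_class_add_scaleR[OF assms, of "-1"] by simp

text \<open>Pointwise convergence under a square integrable majorant \<open>h\<close> is convergence
  in norm, since (u - U k)^2 is at most (2h)^2. Closedness of the span thus becomes usable in
  arguments about sets and functions.\<close>

lemma expandable_dominated:
  assumes e: "orthonormal_or_zero \<beta> e"
    and U [measurable]: "\<And>k. U k \<in> borel_measurable borel"
    and exp: "\<And>k. ae_class (U k) \<in> expandable \<beta> e"
    and lim: "\<And>t. (\<lambda>k. U k t) \<longlonglongrightarrow> u t"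
    and bound: "\<And>k t. \<bar>U k t\<bar> \<le> h t"
    and h: "integrable lborel (\<lambda>t. (h t)\<^sup>2 * exp (- \<beta> * t\<^sup>2))"
  shows "ae_class u \<in> expandable \<beta> e"
proof -
  have u [measurable]: "u \<in> borel_measurable borel"
    by (rule borel_measurable_LIMSEQ_real[OF lim]) simp
  have u_le: "\<bar>u t\<bar> \<le> h t" for t
    by (rule LIMSEQ_le_const2[OF tendsto_rabs[OF lim]]) (use bound in auto)
  have sq_le: "x\<^sup>2 * exp (- \<beta> * t\<^sup>2) \<le> (c * h t)\<^sup>2 * exp (- \<beta> * t\<^sup>2)" if "\<bar>x\<bar> \<le> c * h t" for x t c
  proof -
    have "\<bar>x\<bar>\<^sup>2 \<le> (c * h t)\<^sup>2" using that by (intro power_mono) auto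
    then show ?thesis by (intro mult_right_mono) auto
  qed
  have uL: "ae_class u \<in> L2 \<beta>"
    unfolding ae_class_in_L2_iff[OF u]
  proof (rule Bochner_Integration.integrable_bound[OF h])
    show "AE t in lborel. norm ((u t)\<^sup>2 * exp (- \<beta> * t\<^sup>2)) \<le> norm ((h t)\<^sup>2 * exp (- \<beta> * t\<^sup>2))"
      using sq_le[of "u t" 1 t for t] u_le by (auto simp: abs_mult)
  qed measurable
  show ?thesis
  proof (rule expandable_limit[OF e exp uL])
    have "(\<lambda>k. LINT t|lborel. (u t - U k t)\<^sup>2 * exp (- \<beta> * t\<^sup>2)) \<longlonglongrightarrow> (LINT t|(lborel :: real measure). 0)"
    proof (rule integral_dominated_convergence)
      show "integrable lborel (\<lambda>t. (2 * h t)\<^sup>2 * exp (- \<beta> * t\<^sup>2))"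
        using integrable_mult_right[OF h, of 4] by (simp add: power_mult_distrib mult.assoc)
      show "AE t in lborel. (\<lambda>k. (u t - U k t)\<^sup>2 * exp (- \<beta> * t\<^sup>2)) \<longlonglongrightarrow> 0"
      proof (rule AE_I2)
        fix t
        have "(\<lambda>k. (u t - U k t)\<^sup>2 * exp (- \<beta> * t\<^sup>2)) \<longlonglongrightarrow> (u t - u t)\<^sup>2 * exp (- \<beta> * t\<^sup>2)"
          by (intro tendsto_intros lim)
        then show "(\<lambda>k. (u t - U k t)\<^sup>2 * exp (- \<beta> * t\<^sup>2)) \<longlonglongrightarrow> 0" by simp
      qed
      have "\<bar>u t - U k t\<bar> \<le> 2 * h t" for t k
        using u_le[of t] bound[of k t] by linarith
      then show "AE t in lborel. norm ((u t - U k t)\<^sup>2 * exp (- \<beta> * t\<^sup>2)) \<le> (2 * h t)\<^sup>2 * exp (- \<beta> * t\<^sup>2)" for k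
        using sq_le[of "u t - U k t" 2 t for t] by (auto simp: abs_mult)
    qed auto
    then have "(\<lambda>k. sqrt (LINT t|lborel. (u t - U k t)\<^sup>2 * exp (- \<beta> * t\<^sup>2))) \<longlonglongrightarrow> sqrt 0"
      by (intro tendsto_real_sqrt) simp
    moreover have "L2_norm \<beta> (ae_class u - ae_class (U k))
        = sqrt (LINT t|lborel. (u t - U k t)\<^sup>2 * exp (- \<beta> * t\<^sup>2))" for k
      by (simp add: ae_class_diff L2_norm_def L2_inner_ae_class power2_eq_square)
    ultimately show "(\<lambda>k. L2_norm \<beta> (ae_class u - ae_class (U k))) \<longlonglongrightarrow> 0" by simp
  qed
qed

lemma expandable_ae_class_add_scaleR:
  assumes "orthonormal_or_zero \<beta> e" "f \<in> borel_measurable borel" "g \<in> borel_measurable borel"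
    "ae_class f \<in> expandable \<beta> e" "ae_class g \<in> expandable \<beta> e"
  shows "ae_class (\<lambda>t. f t + c * g t) \<in> expandable \<beta> e"
  using expandable_add_scaleR[of e \<beta> "ae_class f" "ae_class g" c] assms
  by (auto simp: ae_class_add_scaleR orthonormal_or_zero_def)

text \<open>Half-lines form an intersection-stable generator of the Borel sets, and the sets whose
  indicator is expandable form a Dynkin system. Complements use the constant 1, which is square
  integrable because \<beta> > 0 and also dominates all indicators.\<close>

lemma expandable_indicator:
  fixes q :: "nat \<Rightarrow> rat"
  assumes \<beta>: "0 < \<beta>" and e: "orthonormal_or_zero \<beta> e" and q: "surj q"
    and v: "\<And>n. ae_class (indicator {..real_of_rat (q n)}) \<in> expandable \<beta> e"
    and A: "A \<in> sets borel"
  shows "ae_class (indicator A) \<in> expandable \<beta> e"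
proof -
  have one: "integrable lborel (\<lambda>t::real. 1\<^sup>2 * exp (- \<beta> * t\<^sup>2))"
    using integrable_gaussian[OF \<beta>] by simp
  note dom = expandable_dominated[OF e _ _ _ _ one]
  have half: "ae_class (indicator {..a}) \<in> expandable \<beta> e" for a :: real
  proof -
    \<comment> \<open>The endpoint is approached from the right, so that the limit of the half-lines
      still contains \<open>a\<close>.\<close>
    have "\<exists>n. a < real_of_rat (q n) \<and> real_of_rat (q n) < a + 1 / Suc k" for k
    proof -
      have "a < a + 1 / Suc k" by simp
      from of_rat_dense[OF this] obtain r where "a < real_of_rat r" "real_of_rat r < a + 1 / Suc k" by auto
      moreover obtain n where "r = q n" using q by (metis surjD)
      ultimately show ?thesis by auto
    qed
    then obtain n where n: "\<And>k. a < real_of_rat (q (n k))" "\<And>k. real_of_rat (q (n k)) < a + 1 / Suc k"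
      by metis
    show ?thesis
    proof (rule dom)
      show "ae_class (indicator {..real_of_rat (q (n k))}) \<in> expandable \<beta> e" for k by (rule v)
      fix t :: real
      show "(\<lambda>k. indicator {..real_of_rat (q (n k))} t :: real) \<longlonglongrightarrow> indicator {..a} t"
      proof (cases "t \<le> a")
        case True
        then have "t \<le> real_of_rat (q (n k))" for k using n(1)[of k] by linarith
        with True show ?thesis by (simp add: indicator_def)
      next
        case False
        have "(\<lambda>k. a + 1 / Suc k) \<longlonglongrightarrow> a + 0"
          by (intro tendsto_intros LIMSEQ_Suc[OF lim_1_over_n])
        then have "\<forall>\<^sub>F k in sequentially. a + 1 / Suc k < t"
          using False by (intro order_tendstoD(2)[where y = a]) auto
        then have "\<forall>\<^sub>F k in sequentially. indicator {..real_of_rat (q (n k))} t = (indicator {..a} t :: real)"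
          by eventually_elim (use n(2) False in \<open>auto simp: indicator_def\<close>, smt (verit) n(2))
        then show ?thesis by (rule tendsto_eventually)
      qed
    qed (auto simp: indicator_def)
  qed
  have univ: "ae_class (\<lambda>_. 1) \<in> expandable \<beta> e"
  proof (rule dom[where U = "\<lambda>k::nat. indicator {..real k}"])
    fix t :: real
    have "\<forall>\<^sub>F k in sequentially. indicator {..real k} t = (1::real)"
      using eventually_ge_at_top[of "nat \<lceil>t\<rceil>"]
      by eventually_elim (auto simp: indicator_def)
    then show "(\<lambda>k. indicator {..real k} t) \<longlonglongrightarrow> (1::real)" by (rule tendsto_eventually)
  qed (auto simp: half indicator_def)
  have "Int_stable (range (\<lambda>a::real. {..a}))"
    by (auto simp: Int_stable_def)
  moreover have "range (\<lambda>a::real. {..a}) \<subseteq> Pow UNIV" by simp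
  moreover have "A \<in> sigma_sets UNIV (range (\<lambda>a::real. {..a}))"
    using A by (simp add: borel_eq_atMost)
  ultimately show ?thesis
  proof (induction A rule: sigma_sets_induct_disjoint)
    case (basic A)
    then show ?case using half by auto
  next
    case empty
    show ?case
      using expandable_ae_class_add_scaleR[OF e _ _ univ univ, of "-1"] by (simp add: indicator_def)
  next
    case (compl A)
    then have "A \<in> sets borel" by (simp add: borel_eq_atMost)
    then have "ae_class (\<lambda>t. 1 + (-1) * indicator A t) \<in> expandable \<beta> e"
      using expandable_ae_class_add_scaleR[OF e _ _ univ compl.IH, of "-1"] by simp
    moreover have "(\<lambda>t. 1 + (-1) * indicator A t) = (indicator (UNIV - A) :: real \<Rightarrow> real)"
      by (auto simp: indicator_def fun_eq_iff)
    ultimately show ?case by simp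
  next
    case (union A)
    have A: "A i \<in> sets borel" for i using union by (auto simp: borel_eq_atMost)
    have sum: "(\<lambda>t. \<Sum>i<n. indicator (A i) t :: real) \<in> borel_measurable borel \<and>
       ae_class (\<lambda>t. \<Sum>i<n. indicator (A i) t) \<in> expandable \<beta> e" for n
    proof (induction n)
      case 0
      show ?case
        using expandable_ae_class_add_scaleR[OF e _ _ univ univ, of "-1"] by simp
    next
      case (Suc n)
      then show ?case
        using expandable_ae_class_add_scaleR[OF e _ _ _ union.IH[of n], of "\<lambda>t. \<Sum>i<n. indicator (A i) t" 1] A
        by auto
    qed
    \<comment> \<open>Disjointness keeps the partial sums bounded by 1, as the domination
      requires.\<close>
    have eq: "(\<Sum>i<n. indicator (A i) t) = (indicator (\<Union>i<n. A i) t :: real)" for n t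
      by (subst indicator_UN_disjoint) (use union(1) in \<open>auto simp: disjoint_family_on_def\<close>)
    show ?case
    proof (rule dom[where U = "\<lambda>n t. \<Sum>i<n. indicator (A i) t"])
      fix t
      show "(\<lambda>n. \<Sum>i<n. indicator (A i) t) \<longlonglongrightarrow> (indicator (\<Union> (range A)) t :: real)"
        unfolding eq by (rule LIMSEQ_indicator_UN)
      show "\<bar>\<Sum>i<n. indicator (A i) t\<bar> \<le> (1::real)" for n
        unfolding eq by (simp add: indicator_def)
    qed (use sum in auto)
  qed
qed

text \<open>Approximation from below by simple functions: the function itself dominates the
  approximants, and nonnegativity passes square integrability from a sum down to its
  summands.\<close>

lemma expandable_nonneg:
  assumes e: "orthonormal_or_zero \<beta> e"
    and ind: "\<And>A. A \<in> sets borel \<Longrightarrow> ae_class (indicator A) \<in> expandable \<beta> e"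
    and f: "f \<in> borel_measurable borel" "\<And>t. 0 \<le> f t" and fL: "ae_class f \<in> L2 \<beta>"
  shows "ae_class f \<in> expandable \<beta> e"
proof -
  have zero: "ae_class (\<lambda>_. 0) \<in> expandable \<beta> e"
  proof -
    have "indicator {} = (\<lambda>_::real. 0::real)" by (simp add: fun_eq_iff)
    then show ?thesis using ind[of "{}"] by simp
  qed
  from f fL show ?thesis
  proof (induction f rule: borel_measurable_induct_real)
    case (set A)
    then show ?case by (simp add: ind)
  next
    case (mult u c)
    show ?case
    \<comment> \<open>For c = 0 the premise says nothing about \<open>u\<close>, which need not be
      square integrable, so the induction hypothesis is out of reach. Otherwise \<open>u\<close> is
      recovered by dividing by \<open>c\<close>.\<close>
    proof (cases "c = 0")
      case True
      then show ?thesis using zero by simp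
    next
      case False
      have "ae_class u \<in> L2 \<beta>"
      proof -
        have "ae_class (\<lambda>t. 0 + (1 / c) * (c * u t)) \<in> L2 \<beta>"
          using L2_scaleR[OF mult.prems, of "1 / c"] mult.hyps
          by (subst ae_class_add_scaleR[symmetric]) (auto simp flip: zero_ae_fun_def)
        then show ?thesis using False by simp
      qed
      then show ?thesis
        using expandable_ae_class_add_scaleR[OF e _ _ zero mult.IH, of c] mult.hyps by simp
    qed
  next
    case (add u v)
    have "integrable lborel (\<lambda>t. (u t)\<^sup>2 * exp (- \<beta> * t\<^sup>2))" "integrable lborel (\<lambda>t. (v t)\<^sup>2 * exp (- \<beta> * t\<^sup>2))"
    proof -
      have i: "integrable lborel (\<lambda>t. (v t + u t)\<^sup>2 * exp (- \<beta> * t\<^sup>2))"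
        using add by (subst (asm) ae_class_in_L2_iff) auto
      show "integrable lborel (\<lambda>t. (u t)\<^sup>2 * exp (- \<beta> * t\<^sup>2))" "integrable lborel (\<lambda>t. (v t)\<^sup>2 * exp (- \<beta> * t\<^sup>2))"
        by (rule Bochner_Integration.integrable_bound[OF i];
            use add in \<open>auto intro!: mult_right_mono power_mono simp: abs_mult\<close>)+
    qed
    then have "ae_class u \<in> L2 \<beta>" "ae_class v \<in> L2 \<beta>"
      using add by (auto simp: ae_class_in_L2_iff)
    then show ?case
      using expandable_ae_class_add_scaleR[OF e _ _ add.IH(2) add.IH(1), of 1] add.hyps by simp
  next
    case (seq U)
    have le: "U k t \<le> f t" for k t
      using seq by (intro incseq_le) (auto simp: incseq_def le_fun_def)
    have i: "integrable lborel (\<lambda>t. (f t)\<^sup>2 * exp (- \<beta> * t\<^sup>2))"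
      using seq.prems f by (simp add: ae_class_in_L2_iff)
    have "integrable lborel (\<lambda>t. (U k t)\<^sup>2 * exp (- \<beta> * t\<^sup>2))" for k
      by (rule Bochner_Integration.integrable_bound[OF i];
            use seq.hyps le in \<open>auto intro!: mult_right_mono power_mono simp: abs_mult\<close>)
    then have "ae_class (U k) \<in> expandable \<beta> e" for k
      using seq.IH seq.hyps by (simp add: ae_class_in_L2_iff)
    then show ?case
      by (rule expandable_dominated[OF e _ _ _ _ i, rotated]) (use seq.hyps le in auto)
  qed
qed

text \<open>One system serves every vector of the space, so the identity may later be applied to
  \<open>W \<omega>\<close> for each \<omega> without an exceptional null set.\<close>

lemma L2_parseval_system:
  assumes \<beta>: "0 < \<beta>"
  obtains e :: "nat \<Rightarrow> ae_fun" where "\<And>i. e i \<in> L2 \<beta>"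
    "\<And>f. f \<in> L2 \<beta> \<Longrightarrow> (\<lambda>i. (L2_inner \<beta> f (e i))\<^sup>2) sums L2_inner \<beta> f f"
proof -
  define q :: "nat \<Rightarrow> rat" where "q = from_nat"
  have q: "surj q" unfolding q_def by (rule surj_from_nat)
  define v where "v n = ae_class (indicator {..real_of_rat (q n)})" for n
  have v: "v n \<in> L2 \<beta>" for n
    unfolding v_def
  proof (subst ae_class_in_L2_iff)
    show "integrable lborel (\<lambda>t. (indicator {..real_of_rat (q n)} t)\<^sup>2 * exp (- \<beta> * t\<^sup>2))"
      by (rule Bochner_Integration.integrable_bound[OF integrable_gaussian[OF \<beta>]])
        (auto simp: indicator_def)
  qed auto
  define e where "e = gram_schmidt \<beta> v"
  have e: "orthonormal_or_zero \<beta> e" unfolding e_def by (rule orthonormal_or_zero_gram_schmidt[OF v])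
  have ind: "ae_class (indicator A) \<in> expandable \<beta> e" if "A \<in> sets borel" for A
    by (rule expandable_indicator[OF \<beta> e q _ that])
      (rule gram_schmidt_expandable[where v = v, OF v, folded e_def, unfolded v_def])
  have all: "f \<in> expandable \<beta> e" if f: "f \<in> L2 \<beta>" for f
  proof -
    obtain g where [measurable]: "g \<in> borel_measurable borel" and g: "f = ae_class g"
      by (rule ae_fun_cases)
    have i: "integrable lborel (\<lambda>t. (g t)\<^sup>2 * exp (- \<beta> * t\<^sup>2))"
      using f by (simp add: g ae_class_in_L2_iff)
    have "integrable lborel (\<lambda>t. (max 0 (g t))\<^sup>2 * exp (- \<beta> * t\<^sup>2))"
      "integrable lborel (\<lambda>t. (max 0 (- g t))\<^sup>2 * exp (- \<beta> * t\<^sup>2))"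
      by (rule Bochner_Integration.integrable_bound[OF i]; auto simp: max_def)+
    then have "ae_class (\<lambda>t. max 0 (g t) + (-1) * max 0 (- g t)) \<in> expandable \<beta> e"
      by (intro expandable_ae_class_add_scaleR[OF e] expandable_nonneg[OF e ind])
        (auto simp: ae_class_in_L2_iff)
    moreover have "(\<lambda>t. max 0 (g t) + (-1) * max 0 (- g t)) = g"
      by (auto simp: max_def fun_eq_iff)
    ultimately show ?thesis by (simp add: g)
  qed
  show ?thesis
    using e all expandable_sums[OF e] by (intro that[of e]) (auto simp: orthonormal_or_zero_def)
qed

section \<open>Sums of squares of jointly normal variables\<close>

context prob_space
begin

text \<open>Expressing the fourth moment by the second one instead of by a standard deviation gives
  the point mass at 0, which has no density, the same formula as the proper normal case.\<close>

lemma centred_normal_fourth_moment: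
  assumes "centred_normal M X"
  shows "integrable M (\<lambda>\<omega>. (X \<omega>) ^ 4)" "expectation (\<lambda>\<omega>. (X \<omega>) ^ 4) = 3 * (expectation (\<lambda>\<omega>. (X \<omega>)\<^sup>2))\<^sup>2"
proof -
  have [measurable]: "X \<in> borel_measurable M" using assms by (simp add: centred_normal_def)
  have "integrable M (\<lambda>\<omega>. (X \<omega>) ^ 4) \<and> expectation (\<lambda>\<omega>. (X \<omega>) ^ 4) = 3 * (expectation (\<lambda>\<omega>. (X \<omega>)\<^sup>2))\<^sup>2"
  proof (cases "AE \<omega> in M. X \<omega> = 0")
    case True
    then have "AE \<omega> in M. X \<omega> ^ 4 = 0" "AE \<omega> in M. (X \<omega>)\<^sup>2 = 0" by auto
    then have "integrable M (\<lambda>\<omega>. X \<omega> ^ 4)" "expectation (\<lambda>\<omega>. X \<omega> ^ 4) = 0" "expectation (\<lambda>\<omega>. (X \<omega>)\<^sup>2) = 0"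
      using integrable_cong_AE[of "\<lambda>\<omega>. X \<omega> ^ 4" M "\<lambda>_. 0"]
        integral_cong_AE[of "\<lambda>\<omega>. X \<omega> ^ 4" M "\<lambda>_. 0"] integral_cong_AE[of "\<lambda>\<omega>. (X \<omega>)\<^sup>2" M "\<lambda>_. 0"]
      by simp_all
    then show ?thesis by simp
  next
    case False
    then obtain \<sigma> where \<sigma>: "\<sigma> > 0" and D: "distributed M lborel X (normal_density 0 \<sigma>)"
      using assms by (auto simp: centred_normal_def)
    have 4: "has_bochner_integral lborel (\<lambda>x. normal_density 0 \<sigma> x * x ^ 4) (3 * \<sigma> ^ 4)"
      using normal_moment_even[OF \<sigma>, of 0 2] by (simp add: fact_numeral power_divide power_mult_distrib)
    have 2: "has_bochner_integral lborel (\<lambda>x. normal_density 0 \<sigma> x * x ^ 2) (\<sigma> ^ 2)"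
      using normal_moment_even[OF \<sigma>, of 0 1] by (simp add: fact_numeral)
    have "integrable M (\<lambda>\<omega>. (X \<omega>) ^ 4)"
      using distributed_integrable[OF D, of "\<lambda>x. x ^ 4"] 4 by (auto simp: has_bochner_integral_iff)
    moreover have "expectation (\<lambda>\<omega>. (X \<omega>) ^ 4) = 3 * \<sigma> ^ 4"
      using distributed_integral[OF D, of "\<lambda>x. x ^ 4"] 4 by (auto simp: has_bochner_integral_iff)
    moreover have "expectation (\<lambda>\<omega>. (X \<omega>) ^ 2) = \<sigma> ^ 2"
      using distributed_integral[OF D, of "\<lambda>x. x ^ 2"] 2 by (auto simp: has_bochner_integral_iff)
    ultimately show ?thesis by (simp add: power_mult[symmetric])
  qed
  then show "integrable M (\<lambda>\<omega>. (X \<omega>) ^ 4)" "expectation (\<lambda>\<omega>. (X \<omega>) ^ 4) = 3 * (expectation (\<lambda>\<omega>. (X \<omega>)\<^sup>2))\<^sup>2"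
    by auto
qed

lemma centred_normal_square_integrable:
  assumes "centred_normal M X"
  shows "integrable M (\<lambda>\<omega>. (X \<omega>)\<^sup>2)"
proof (rule square_integrable_imp_integrable)
  show "(\<lambda>\<omega>. (X \<omega>)\<^sup>2) \<in> borel_measurable M" using assms by (auto simp: centred_normal_def)
  show "integrable M (\<lambda>\<omega>. ((X \<omega>)\<^sup>2)\<^sup>2)"
    using centred_normal_fourth_moment(1)[OF assms] by (simp add: power_mult[symmetric])
qed

text \<open>Isserlis' formula, by polarization of the fourth moment.\<close>

lemma centred_normal_product_squares:
  assumes X: "centred_normal M X" and Y: "centred_normal M Y"
    and add: "centred_normal M (\<lambda>\<omega>. X \<omega> + Y \<omega>)" and diff: "centred_normal M (\<lambda>\<omega>. X \<omega> - Y \<omega>)"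
  shows "has_bochner_integral M (\<lambda>\<omega>. (X \<omega>)\<^sup>2 * (Y \<omega>)\<^sup>2)
    (expectation (\<lambda>\<omega>. (X \<omega>)\<^sup>2) * expectation (\<lambda>\<omega>. (Y \<omega>)\<^sup>2) + 2 * (expectation (\<lambda>\<omega>. X \<omega> * Y \<omega>))\<^sup>2)"
proof -
  have [measurable]: "X \<in> borel_measurable M" "Y \<in> borel_measurable M"
    using X Y by (auto simp: centred_normal_def)
  note i [simp] = X[THEN centred_normal_square_integrable] Y[THEN centred_normal_square_integrable]
    X[THEN centred_normal_fourth_moment(1)] Y[THEN centred_normal_fourth_moment(1)]
    add[THEN centred_normal_fourth_moment(1)] diff[THEN centred_normal_fourth_moment(1)]
  have "integrable M (\<lambda>\<omega>. ((X \<omega> + Y \<omega>)\<^sup>2 - (X \<omega>)\<^sup>2 - (Y \<omega>)\<^sup>2) / 2)"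
    using centred_normal_square_integrable[OF add] by simp
  moreover have "((X \<omega> + Y \<omega>)\<^sup>2 - (X \<omega>)\<^sup>2 - (Y \<omega>)\<^sup>2) / 2 = X \<omega> * Y \<omega>" for \<omega>
    by (simp add: power2_sum)
  ultimately have [simp]: "integrable M (\<lambda>\<omega>. X \<omega> * Y \<omega>)" by simp
  let ?a = "expectation (\<lambda>\<omega>. (X \<omega>)\<^sup>2)" and ?b = "expectation (\<lambda>\<omega>. (Y \<omega>)\<^sup>2)" and ?c = "expectation (\<lambda>\<omega>. X \<omega> * Y \<omega>)"
  have p: "expectation (\<lambda>\<omega>. (X \<omega> + Y \<omega>)\<^sup>2) = ?a + 2 * ?c + ?b"
    by (simp add: power2_sum mult.assoc)
  have m: "expectation (\<lambda>\<omega>. (X \<omega> - Y \<omega>)\<^sup>2) = ?a - 2 * ?c + ?b"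
    by (simp add: power2_diff mult.assoc)
  have eq: "(X \<omega>)\<^sup>2 * (Y \<omega>)\<^sup>2 =
    ((X \<omega> + Y \<omega>) ^ 4 + (X \<omega> - Y \<omega>) ^ 4 - 2 * (X \<omega>) ^ 4 - 2 * (Y \<omega>) ^ 4) / 12" for \<omega>
    by (simp add: power4_eq_xxxx power2_eq_square algebra_simps)
  have "has_bochner_integral M (\<lambda>\<omega>. ((X \<omega> + Y \<omega>) ^ 4 + (X \<omega> - Y \<omega>) ^ 4 - 2 * (X \<omega>) ^ 4 - 2 * (Y \<omega>) ^ 4) / 12)
    ((3 * (?a + 2 * ?c + ?b)\<^sup>2 + 3 * (?a - 2 * ?c + ?b)\<^sup>2 - 2 * (3 * ?a\<^sup>2) - 2 * (3 * ?b\<^sup>2)) / 12)"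
    by (simp add: has_bochner_integral_iff X[THEN centred_normal_fourth_moment(2)]
      Y[THEN centred_normal_fourth_moment(2)] add[THEN centred_normal_fourth_moment(2)]
      diff[THEN centred_normal_fourth_moment(2)] p m)
  also have "(3 * (?a + 2 * ?c + ?b)\<^sup>2 + 3 * (?a - 2 * ?c + ?b)\<^sup>2 - 2 * (3 * ?a\<^sup>2) - 2 * (3 * ?b\<^sup>2)) / 12
    = ?a * ?b + 2 * ?c\<^sup>2"
    by (simp add: power2_eq_square algebra_simps)
  finally show ?thesis unfolding eq .
qed

text \<open>All terms are nonnegative, so sums and expectations are exchanged in
  \<open>ennreal\<close> without any summability condition. Finiteness of \<open>m\<close> and
  \<open>v\<close> then yields integrability of \<open>T\<close> and of its square.\<close>

lemma gaussian_square_sum_moments: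
  fixes X :: "nat \<Rightarrow> 'a \<Rightarrow> real"
  assumes X: "\<And>i. centred_normal M (X i)"
    and add: "\<And>i j. centred_normal M (\<lambda>\<omega>. X i \<omega> + X j \<omega>)"
    and diff: "\<And>i j. centred_normal M (\<lambda>\<omega>. X i \<omega> - X j \<omega>)"
    and T: "\<And>\<omega>. \<omega> \<in> space M \<Longrightarrow> (\<lambda>i. (X i \<omega>)\<^sup>2) sums T \<omega>"
    and m: "(\<Sum>i. ennreal (expectation (\<lambda>\<omega>. (X i \<omega>)\<^sup>2))) = ennreal m" "0 \<le> m"
    and v: "(\<Sum>i. \<Sum>j. ennreal ((expectation (\<lambda>\<omega>. X i \<omega> * X j \<omega>))\<^sup>2)) = ennreal v" "0 \<le> v"
  shows "integrable M T \<and> expectation T = m \<and> integrable M (\<lambda>\<omega>. (T \<omega>)\<^sup>2) \<and> variance T = 2 * v"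
proof -
  have [measurable]: "X i \<in> borel_measurable M" for i
    using X by (auto simp: centred_normal_def)
  have T_eq: "T \<omega> = (\<Sum>i. (X i \<omega>)\<^sup>2)" if "\<omega> \<in> space M" for \<omega>
    using T[OF that] by (rule sums_unique)
  have [measurable]: "T \<in> borel_measurable M"
    by (subst measurable_cong[OF T_eq]) auto
  have T_nn: "0 \<le> T \<omega>" if "\<omega> \<in> space M" for \<omega>
    by (rule sums_le[OF _ sums_zero T[OF that]]) simp
  have T_enn: "ennreal (T \<omega>) = (\<Sum>i. ennreal ((X i \<omega>)\<^sup>2))" if "\<omega> \<in> space M" for \<omega>
    by (rule sym, rule suminf_ennreal_eq[OF _ T[OF that]]) simp
  define s where "s i j = expectation (\<lambda>\<omega>. X i \<omega> * X j \<omega>)" for i j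
  have s_diag: "expectation (\<lambda>\<omega>. (X i \<omega>)\<^sup>2) = s i i" for i
    by (simp add: s_def power2_eq_square)
  have s_nn: "0 \<le> s i i" for i
    unfolding s_def by (intro integral_nonneg_AE) auto
  have "(\<integral>\<^sup>+\<omega>. T \<omega> \<partial>M) = (\<integral>\<^sup>+\<omega>. (\<Sum>i. ennreal ((X i \<omega>)\<^sup>2)) \<partial>M)"
    by (intro nn_integral_cong T_enn)
  also have "\<dots> = (\<Sum>i. \<integral>\<^sup>+\<omega>. ennreal ((X i \<omega>)\<^sup>2) \<partial>M)"
    by (intro nn_integral_suminf) auto
  also have "\<dots> = ennreal m"
    unfolding m(1)[symmetric]
    by (intro suminf_cong nn_integral_eq_integral centred_normal_square_integrable X) auto
  finally have ET: "(\<integral>\<^sup>+\<omega>. T \<omega> \<partial>M) = ennreal m" .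
  have T_bochner: "has_bochner_integral M T m"
    by (rule has_bochner_integral_nn_integral) (use ET T_nn m in auto)
  have "(\<integral>\<^sup>+\<omega>. ennreal ((T \<omega>)\<^sup>2) \<partial>M) = (\<integral>\<^sup>+\<omega>. (\<Sum>i. \<Sum>j. ennreal ((X i \<omega>)\<^sup>2 * (X j \<omega>)\<^sup>2)) \<partial>M)"
  proof (intro nn_integral_cong)
    fix \<omega> assume \<omega>: "\<omega> \<in> space M"
    have "ennreal ((T \<omega>)\<^sup>2) = ennreal (T \<omega>) * ennreal (T \<omega>)"
      using T_nn[OF \<omega>] by (simp add: power2_eq_square ennreal_mult)
    then show "ennreal ((T \<omega>)\<^sup>2) = (\<Sum>i. \<Sum>j. ennreal ((X i \<omega>)\<^sup>2 * (X j \<omega>)\<^sup>2))"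
      by (simp add: T_enn[OF \<omega>] ennreal_mult)
  qed
  also have "\<dots> = (\<Sum>i. \<integral>\<^sup>+\<omega>. (\<Sum>j. ennreal ((X i \<omega>)\<^sup>2 * (X j \<omega>)\<^sup>2)) \<partial>M)"
    by (intro nn_integral_suminf) measurable
  also have "\<dots> = (\<Sum>i. \<Sum>j. \<integral>\<^sup>+\<omega>. ennreal ((X i \<omega>)\<^sup>2 * (X j \<omega>)\<^sup>2) \<partial>M)"
    by (intro suminf_cong nn_integral_suminf) measurable
  also have "\<dots> = (\<Sum>i. \<Sum>j. ennreal (s i i) * ennreal (s j j) + 2 * ennreal ((s i j)\<^sup>2))"
  proof (intro suminf_cong)
    fix i j
    have hb: "has_bochner_integral M (\<lambda>\<omega>. (X i \<omega>)\<^sup>2 * (X j \<omega>)\<^sup>2) (s i i * s j j + 2 * (s i j)\<^sup>2)"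
      using centred_normal_product_squares[OF X X add diff, of i j]
      by (simp only: s_diag) (simp only: s_def)
    then have "(\<integral>\<^sup>+\<omega>. ennreal ((X i \<omega>)\<^sup>2 * (X j \<omega>)\<^sup>2) \<partial>M) = ennreal (s i i * s j j + 2 * (s i j)\<^sup>2)"
      by (subst nn_integral_eq_integral) (auto simp: has_bochner_integral_iff)
    then show "(\<integral>\<^sup>+\<omega>. ennreal ((X i \<omega>)\<^sup>2 * (X j \<omega>)\<^sup>2) \<partial>M) = ennreal (s i i) * ennreal (s j j) + 2 * ennreal ((s i j)\<^sup>2)"
      by (simp add: ennreal_mult s_nn)
  qed
  also have "\<dots> = (\<Sum>i. \<Sum>j. ennreal (s i i) * ennreal (s j j)) + (\<Sum>i. \<Sum>j. 2 * ennreal ((s i j)\<^sup>2))"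
    by (simp only: suminf_add[OF summableI summableI, symmetric])
  \<comment> \<open>The first double series factors into the square of the mean, which the variance
    subtracts again; only the covariances remain.\<close>
  also have "\<dots> = ennreal m * ennreal m + 2 * ennreal v"
    using m v by (simp add: s_def power2_eq_square)
  also have "\<dots> = ennreal (m\<^sup>2 + 2 * v)"
    using m v by (simp add: ennreal_mult power2_eq_square)
  finally have ET2: "(\<integral>\<^sup>+\<omega>. ennreal ((T \<omega>)\<^sup>2) \<partial>M) = ennreal (m\<^sup>2 + 2 * v)" .
  have T2_bochner: "has_bochner_integral M (\<lambda>\<omega>. (T \<omega>)\<^sup>2) (m\<^sup>2 + 2 * v)"
    by (rule has_bochner_integral_nn_integral) (use ET2 m v in auto)
  show ?thesis
    using T_bochner T2_bochner variance_eq[of T] by (auto simp: has_bochner_integral_iff)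
qed

end

section \<open>The covariance operator\<close>

text \<open>Tonelli, with one sum read as an integral over the counting measure.\<close>

lemma ennreal_suminf_swap:
  fixes f :: "nat \<Rightarrow> nat \<Rightarrow> ennreal"
  shows "(\<Sum>i. \<Sum>j. f i j) = (\<Sum>j. \<Sum>i. f i j)"
  using nn_integral_suminf[of "\<lambda>j i. f i j" "count_space UNIV"]
  by (simp add: nn_integral_count_space_nat)

text \<open>The kernel is the sum of the products \<open>mercer_fun k s * mercer_fun k t\<close>.
  The shift by 3 reflects that K omits the first three terms of the series of e^(ts). These
  functions are not eigenfunctions: those with indices of equal parity are not orthogonal. What
  matters is that K becomes a sum of squares on the diagonal.\<close>

definition mercer_fun :: "nat \<Rightarrow> real \<Rightarrow> real" where
  "mercer_fun k t = exp (t\<^sup>2 / 2) * t ^ (k + 3) / sqrt (fact (k + 3))"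

lemma mercer_fun_measurable [measurable]: "mercer_fun k \<in> borel_measurable borel"
  unfolding mercer_fun_def by measurable

lemma limit_kernel_measurable [measurable]:
  "(\<lambda>x. limit_kernel (f x) (g x)) \<in> borel_measurable M"
  if [measurable]: "f \<in> borel_measurable M" "g \<in> borel_measurable M"
  unfolding limit_kernel_def by measurable

lemma limit_kernel_commute: "limit_kernel s t = limit_kernel t s"
  by (simp add: limit_kernel_def algebra_simps)

lemma exp_tail_sums: "(\<lambda>k. x ^ (k + 3) / fact (k + 3)) sums (exp x - 1 - x - x\<^sup>2 / 2)" for x :: real
proof -
  have "(\<lambda>k. x ^ k / fact k) sums exp x"
    using exp_converges[of x] by (simp add: divide_inverse mult.commute)
  then have "(\<lambda>k. x ^ (k + 3) / fact (k + 3)) sums (exp x - (\<Sum>k<3. x ^ k / fact k))"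
    by (rule sums_split_initial_segment)
  moreover have "exp x - (\<Sum>k<3. x ^ k / fact k) = exp x - 1 - x - x\<^sup>2 / 2"
    by (simp add: eval_nat_numeral)
  ultimately show ?thesis by simp
qed

lemma mercer_fun_mult:
  "mercer_fun k s * mercer_fun k t = exp ((t\<^sup>2 + s\<^sup>2) / 2) * ((t * s) ^ (k + 3) / fact (k + 3))"
proof -
  have 1: "sqrt (fact (k + 3)) * sqrt (fact (k + 3)) = (fact (k + 3) :: real)" by simp
  have 2: "exp (s\<^sup>2 / 2) * exp (t\<^sup>2 / 2) = exp ((t\<^sup>2 + s\<^sup>2) / 2)"
    by (simp add: exp_add[symmetric] add_divide_distrib)
  have 3: "a * b / c * (a' * b' / c) = (a * a') * ((b' * b) / (c * c))" for a b c a' b' :: real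
    by simp
  show ?thesis
    unfolding mercer_fun_def 3 power_mult_distrib 1 2 ..
qed

lemma limit_kernel_sums: "(\<lambda>k. mercer_fun k s * mercer_fun k t) sums limit_kernel s t"
  unfolding mercer_fun_mult limit_kernel_def
  using sums_mult[OF exp_tail_sums[of "t * s"]] by (simp add: power_mult_distrib)

lemma limit_kernel_diagonal_nonneg: "0 \<le> limit_kernel t t"
  by (rule sums_le[OF _ sums_zero limit_kernel_sums]) simp

text \<open>From |ts| <= (s^2 + t^2) / 2 the exponential series is bounded by the very prefactor of
  the kernel. The bound is uniform in \<open>n\<close> and splits into a function of
  \<open>s\<close> times a function of \<open>t\<close>; it supplies the majorants for the limits
  under the integral below.\<close>

lemma mercer_sum_bound: "\<bar>\<Sum>k<n. mercer_fun k s * mercer_fun k t\<bar> \<le> exp (s\<^sup>2) * exp (t\<^sup>2)"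
proof -
  have "(\<Sum>k<n. \<bar>t * s\<bar> ^ (k + 3) / fact (k + 3)) \<le> (\<Sum>k. \<bar>t * s\<bar> ^ (k + 3) / fact (k + 3))"
    using exp_tail_sums[of "\<bar>t * s\<bar>"] by (intro sum_le_suminf) (auto simp: sums_iff)
  \<comment> \<open>The polynomial subtracted from the exponential is nonnegative at |ts|.\<close>
  also have "\<dots> \<le> exp \<bar>t * s\<bar>"
    unfolding sums_unique[OF exp_tail_sums, symmetric]
    using zero_le_power2[of "\<bar>t * s\<bar>"] abs_ge_zero[of "t * s"] by linarith
  also have "\<dots> \<le> exp ((t\<^sup>2 + s\<^sup>2) / 2)"
    using sum_squares_bound[of "\<bar>t\<bar>" "\<bar>s\<bar>"] by (simp add: abs_mult)
  finally have *: "(\<Sum>k<n. \<bar>t * s\<bar> ^ (k + 3) / fact (k + 3)) \<le> exp ((t\<^sup>2 + s\<^sup>2) / 2)" .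
  have "\<bar>\<Sum>k<n. mercer_fun k s * mercer_fun k t\<bar> \<le> (\<Sum>k<n. \<bar>mercer_fun k s * mercer_fun k t\<bar>)"
    by (rule sum_abs)
  also have "\<dots> = exp ((t\<^sup>2 + s\<^sup>2) / 2) * (\<Sum>k<n. \<bar>t * s\<bar> ^ (k + 3) / fact (k + 3))"
    unfolding mercer_fun_mult by (simp add: abs_mult power_abs sum_distrib_left)
  also have "\<dots> \<le> exp ((t\<^sup>2 + s\<^sup>2) / 2) * exp ((t\<^sup>2 + s\<^sup>2) / 2)"
    using * by (intro mult_left_mono) auto
  also have "\<dots> = exp (s\<^sup>2) * exp (t\<^sup>2)"
    unfolding exp_add[symmetric] by (simp add: field_simps)
  finally show ?thesis .
qed

lemma limit_kernel_bound: "\<bar>limit_kernel s t\<bar> \<le> exp (s\<^sup>2) * exp (t\<^sup>2)"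
  by (rule LIMSEQ_le_const2[OF tendsto_rabs[OF limit_kernel_sums[unfolded sums_def]]])
    (use mercer_sum_bound in blast)

text \<open>The square of \<open>mercer_fun k t\<close> is a single term of a partial sum on the
  diagonal, whose other terms are nonnegative.\<close>

lemma mercer_fun_bound: "\<bar>mercer_fun k t\<bar> \<le> exp (t\<^sup>2)"
proof -
  have "(\<Sum>j\<in>{k}. mercer_fun j t * mercer_fun j t) \<le> (\<Sum>j<Suc k. mercer_fun j t * mercer_fun j t)"
    by (intro sum_mono2) auto
  also have "\<dots> \<le> exp (t\<^sup>2) * exp (t\<^sup>2)"
    by (rule order_trans[OF abs_ge_self mercer_sum_bound])
  finally have "\<bar>mercer_fun k t\<bar>\<^sup>2 \<le> (exp (t\<^sup>2))\<^sup>2" by (simp add: power2_eq_square)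
  then show ?thesis by (rule power2_le_imp_le) simp
qed

text \<open>The square of e^(t^2) leaves the weight e^(-(\<beta> - 2) t^2), integrable since \<beta>
  > 2.\<close>

lemma square_integrable_dominated:
  fixes f :: "real \<Rightarrow> real"
  assumes \<beta>: "\<beta> > 2" and [measurable]: "f \<in> borel_measurable borel" and f: "\<And>t. \<bar>f t\<bar> \<le> C * exp (t\<^sup>2)"
  shows "integrable lborel (\<lambda>t. (f t)\<^sup>2 * exp (- \<beta> * t\<^sup>2))"
proof (rule Bochner_Integration.integrable_bound)
  show "integrable lborel (\<lambda>t. C\<^sup>2 * exp (- (\<beta> - 2) * t\<^sup>2))"
    using \<beta> by (intro integrable_mult_right integrable_gaussian) auto
  show "AE t in lborel. norm ((f t)\<^sup>2 * exp (- \<beta> * t\<^sup>2)) \<le> norm (C\<^sup>2 * exp (- (\<beta> - 2) * t\<^sup>2))"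
  proof (rule AE_I2)
    fix t
    have "\<bar>f t\<bar>\<^sup>2 \<le> (C * exp (t\<^sup>2))\<^sup>2" using f[of t] by (intro power_mono) auto
    then have "(f t)\<^sup>2 * exp (- \<beta> * t\<^sup>2) \<le> (C * exp (t\<^sup>2))\<^sup>2 * exp (- \<beta> * t\<^sup>2)"
      by (intro mult_right_mono) auto
    also have "\<dots> = C\<^sup>2 * exp (- (\<beta> - 2) * t\<^sup>2)"
      by (simp add: power_mult_distrib exp_double[symmetric] exp_add[symmetric] algebra_simps)
    finally show "norm ((f t)\<^sup>2 * exp (- \<beta> * t\<^sup>2)) \<le> norm (C\<^sup>2 * exp (- (\<beta> - 2) * t\<^sup>2))" by simp
  qed
qed measurable

lemma ae_class_in_L2_dominated:
  assumes "\<beta> > 2" "f \<in> borel_measurable borel" "\<And>t. \<bar>f t\<bar> \<le> C * exp (t\<^sup>2)"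
  shows "ae_class f \<in> L2 \<beta>"
  using square_integrable_dominated[OF assms] assms(2) by (simp add: ae_class_in_L2_iff)

text \<open>The covariance operator of the Gaussian element. It acts on functions rather than on
  classes so that its result can be evaluated at a point \<open>t\<close>; this is why
  representatives of the basis vectors are carried along below.\<close>

definition kernel_op :: "real \<Rightarrow> (real \<Rightarrow> real) \<Rightarrow> real \<Rightarrow> real" where
  "kernel_op \<beta> f t = (LINT s|lborel. limit_kernel s t * f s * exp (- \<beta> * s\<^sup>2))"

lemma integrable_exp_square_mult:
  assumes \<beta>: "\<beta> > 2" and [measurable]: "f \<in> borel_measurable borel" and f: "ae_class f \<in> L2 \<beta>"
  shows "integrable lborel (\<lambda>s. exp (s\<^sup>2) * \<bar>f s\<bar> * exp (- \<beta> * s\<^sup>2))"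
  using f square_integrable_dominated[OF \<beta>, of "\<lambda>t. exp (t\<^sup>2)" 1]
  by (intro integrable_mult_of_square_integrable) (auto simp: ae_class_in_L2_iff)

context
  fixes \<beta> :: real and f :: "real \<Rightarrow> real"
  assumes \<beta>: "\<beta> > 2" and f_meas [measurable]: "f \<in> borel_measurable borel" and f: "ae_class f \<in> L2 \<beta>"
begin

lemma kernel_op_measurable: "kernel_op \<beta> f \<in> borel_measurable borel"
proof -
  have "(\<lambda>t. LINT s|lborel. limit_kernel s t * f s * exp (- \<beta> * s\<^sup>2)) \<in> borel_measurable lborel"
    by (rule lborel.borel_measurable_lebesgue_integral) measurable
  then show ?thesis unfolding kernel_op_def[abs_def] by simp
qed

text \<open>Stated for a general \<open>h\<close> because it is applied both to a single
  \<open>mercer_fun k\<close> and to partial sums of the kernel expansion with \<open>t\<close>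
  fixed.\<close>

lemma kernel_section_dominated:
  assumes [measurable]: "h \<in> borel_measurable borel" and h: "\<And>s. \<bar>h s\<bar> \<le> exp (s\<^sup>2) * C"
  shows "integrable lborel (\<lambda>s. h s * f s * exp (- \<beta> * s\<^sup>2))"
    and "\<bar>LINT s|lborel. h s * f s * exp (- \<beta> * s\<^sup>2)\<bar> \<le> C * (LINT s|lborel. exp (s\<^sup>2) * \<bar>f s\<bar> * exp (- \<beta> * s\<^sup>2))"
proof -
  note i = integrable_exp_square_mult[OF \<beta> f_meas f]
  have le: "norm (h s * f s * exp (- \<beta> * s\<^sup>2)) \<le> C * (exp (s\<^sup>2) * \<bar>f s\<bar> * exp (- \<beta> * s\<^sup>2))" for s
    using mult_right_mono[OF h[of s], of "\<bar>f s\<bar> * exp (- \<beta> * s\<^sup>2)"] by (simp add: abs_mult mult_ac)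
  show int: "integrable lborel (\<lambda>s. h s * f s * exp (- \<beta> * s\<^sup>2))"
    by (rule Bochner_Integration.integrable_bound[OF integrable_mult_right[OF i, of C]])
      (use order_trans[OF le abs_ge_self] in auto)
  have "norm (LINT s|lborel. h s * f s * exp (- \<beta> * s\<^sup>2)) \<le> (LINT s|lborel. C * (exp (s\<^sup>2) * \<bar>f s\<bar> * exp (- \<beta> * s\<^sup>2)))"
    using i by (intro Bochner_Integration.integral_norm_bound_integral le int integrable_mult_right)
  then show "\<bar>LINT s|lborel. h s * f s * exp (- \<beta> * s\<^sup>2)\<bar> \<le> C * (LINT s|lborel. exp (s\<^sup>2) * \<bar>f s\<bar> * exp (- \<beta> * s\<^sup>2))"
    by simp
qed

lemma mercer_partial_integral:
  "(LINT s|lborel. (\<Sum>k<n. mercer_fun k s * mercer_fun k t) * f s * exp (- \<beta> * s\<^sup>2))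
    = (\<Sum>k<n. mercer_fun k t * L2_inner \<beta> (ae_class (mercer_fun k)) (ae_class f))"
proof -
  have i: "integrable lborel (\<lambda>s. mercer_fun k s * f s * exp (- \<beta> * s\<^sup>2))" for k
    by (rule kernel_section_dominated(1)[where C = 1]) (use mercer_fun_bound in auto)
  have "(LINT s|lborel. (\<Sum>k<n. mercer_fun k s * mercer_fun k t) * f s * exp (- \<beta> * s\<^sup>2))
    = (LINT s|lborel. (\<Sum>k<n. mercer_fun k t * (mercer_fun k s * f s * exp (- \<beta> * s\<^sup>2))))"
    by (intro Bochner_Integration.integral_cong) (auto simp: sum_distrib_left sum_distrib_right mult_ac)
  also have "\<dots> = (\<Sum>k<n. mercer_fun k t * (LINT s|lborel. mercer_fun k s * f s * exp (- \<beta> * s\<^sup>2)))"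
    using i by (subst Bochner_Integration.integral_sum) auto
  finally show ?thesis by (simp add: L2_inner_ae_class)
qed

lemma kernel_op_sums:
  "(\<lambda>k. mercer_fun k t * L2_inner \<beta> (ae_class (mercer_fun k)) (ae_class f)) sums kernel_op \<beta> f t"
  unfolding sums_def mercer_partial_integral[symmetric] kernel_op_def
proof (rule integral_dominated_convergence[where w = "\<lambda>s. exp (t\<^sup>2) * (exp (s\<^sup>2) * \<bar>f s\<bar> * exp (- \<beta> * s\<^sup>2))"])
  show "integrable lborel (\<lambda>s. exp (t\<^sup>2) * (exp (s\<^sup>2) * \<bar>f s\<bar> * exp (- \<beta> * s\<^sup>2)))"
    by (intro integrable_mult_right integrable_exp_square_mult \<beta> f_meas f)
  show "AE s in lborel. (\<lambda>n. (\<Sum>k<n. mercer_fun k s * mercer_fun k t) * f s * exp (- \<beta> * s\<^sup>2))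
      \<longlonglongrightarrow> limit_kernel s t * f s * exp (- \<beta> * s\<^sup>2)"
    using limit_kernel_sums unfolding sums_def by (intro AE_I2 tendsto_intros)
  show "AE s in lborel. norm ((\<Sum>k<n. mercer_fun k s * mercer_fun k t) * f s * exp (- \<beta> * s\<^sup>2))
      \<le> exp (t\<^sup>2) * (exp (s\<^sup>2) * \<bar>f s\<bar> * exp (- \<beta> * s\<^sup>2))" for n
  proof (rule AE_I2)
    fix s
    show "norm ((\<Sum>k<n. mercer_fun k s * mercer_fun k t) * f s * exp (- \<beta> * s\<^sup>2))
      \<le> exp (t\<^sup>2) * (exp (s\<^sup>2) * \<bar>f s\<bar> * exp (- \<beta> * s\<^sup>2))"
      using mult_right_mono[OF mercer_sum_bound[of s t n], of "\<bar>f s\<bar> * exp (- \<beta> * s\<^sup>2)"]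
      by (simp add: abs_mult mult_ac)
  qed
qed measurable

lemma mercer_partial_bound:
  "\<bar>\<Sum>k<n. mercer_fun k t * L2_inner \<beta> (ae_class (mercer_fun k)) (ae_class f)\<bar>
    \<le> (LINT s|lborel. exp (s\<^sup>2) * \<bar>f s\<bar> * exp (- \<beta> * s\<^sup>2)) * exp (t\<^sup>2)"
  unfolding mercer_partial_integral[symmetric]
  using kernel_section_dominated(2)[of "\<lambda>s. \<Sum>k<n. mercer_fun k s * mercer_fun k t" "exp (t\<^sup>2)"] mercer_sum_bound
  by (simp add: mult.commute)

lemma kernel_op_bound:
  "\<bar>kernel_op \<beta> f t\<bar> \<le> (LINT s|lborel. exp (s\<^sup>2) * \<bar>f s\<bar> * exp (- \<beta> * s\<^sup>2)) * exp (t\<^sup>2)"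
  by (rule LIMSEQ_le_const2[OF tendsto_rabs[OF kernel_op_sums[unfolded sums_def]]])
    (use mercer_partial_bound in blast)

lemma kernel_op_in_L2: "ae_class (kernel_op \<beta> f) \<in> L2 \<beta>"
  by (rule ae_class_in_L2_dominated[OF \<beta> kernel_op_measurable kernel_op_bound])

text \<open>Reads the value at \<open>t\<close> as the inner product of \<open>f\<close> with a
  section of the kernel, so that Parseval's identity can be applied for each fixed
  \<open>t\<close>.\<close>

lemma kernel_op_eq_inner: "kernel_op \<beta> f t = L2_inner \<beta> (ae_class (limit_kernel t)) (ae_class f)"
  by (subst L2_inner_ae_class) (auto simp: kernel_op_def limit_kernel_commute[of _ t])

text \<open>Turns the quadratic form of the operator into a series of squares. Besides showing that
  it is nonnegative, this prepares the exchange of sums in the trace.\<close>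

lemma inner_kernel_op_sums:
  "(\<lambda>k. (L2_inner \<beta> (ae_class (mercer_fun k)) (ae_class f))\<^sup>2)
    sums L2_inner \<beta> (ae_class (kernel_op \<beta> f)) (ae_class f)"
proof -
  let ?a = "\<lambda>k. L2_inner \<beta> (ae_class (mercer_fun k)) (ae_class f)"
  let ?C = "LINT s|lborel. exp (s\<^sup>2) * \<bar>f s\<bar> * exp (- \<beta> * s\<^sup>2)"
  have i: "integrable lborel (\<lambda>s. mercer_fun k s * f s * exp (- \<beta> * s\<^sup>2))" for k
    by (rule kernel_section_dominated(1)[where C = 1]) (use mercer_fun_bound in auto)
  have "(\<Sum>k<n. (?a k)\<^sup>2) = (LINT t|lborel. (\<Sum>k<n. mercer_fun k t * ?a k) * f t * exp (- \<beta> * t\<^sup>2))" for n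
  proof -
    have "(LINT t|lborel. (\<Sum>k<n. mercer_fun k t * ?a k) * f t * exp (- \<beta> * t\<^sup>2))
      = (LINT t|lborel. (\<Sum>k<n. ?a k * (mercer_fun k t * f t * exp (- \<beta> * t\<^sup>2))))"
      by (intro Bochner_Integration.integral_cong) (auto simp: sum_distrib_left sum_distrib_right mult_ac)
    also have "\<dots> = (\<Sum>k<n. ?a k * (LINT t|lborel. mercer_fun k t * f t * exp (- \<beta> * t\<^sup>2)))"
      using i by (subst Bochner_Integration.integral_sum) auto
    finally show ?thesis by (simp add: L2_inner_ae_class power2_eq_square)
  qed
  moreover have "(\<lambda>n. LINT t|lborel. (\<Sum>k<n. mercer_fun k t * ?a k) * f t * exp (- \<beta> * t\<^sup>2))
    \<longlonglongrightarrow> (LINT t|lborel. kernel_op \<beta> f t * f t * exp (- \<beta> * t\<^sup>2))"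
  proof (rule integral_dominated_convergence[where w = "\<lambda>t. ?C * (exp (t\<^sup>2) * \<bar>f t\<bar> * exp (- \<beta> * t\<^sup>2))"])
    show "(\<lambda>t. kernel_op \<beta> f t * f t * exp (- \<beta> * t\<^sup>2)) \<in> borel_measurable lborel"
      using kernel_op_measurable by measurable
    show "integrable lborel (\<lambda>t. ?C * (exp (t\<^sup>2) * \<bar>f t\<bar> * exp (- \<beta> * t\<^sup>2)))"
      by (intro integrable_mult_right integrable_exp_square_mult \<beta> f_meas f)
    show "AE t in lborel. (\<lambda>n. (\<Sum>k<n. mercer_fun k t * ?a k) * f t * exp (- \<beta> * t\<^sup>2))
      \<longlonglongrightarrow> kernel_op \<beta> f t * f t * exp (- \<beta> * t\<^sup>2)"
      using kernel_op_sums unfolding sums_def by (intro AE_I2 tendsto_intros)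
    show "AE t in lborel. norm ((\<Sum>k<n. mercer_fun k t * ?a k) * f t * exp (- \<beta> * t\<^sup>2))
      \<le> ?C * (exp (t\<^sup>2) * \<bar>f t\<bar> * exp (- \<beta> * t\<^sup>2))" for n
    proof (rule AE_I2)
      fix t
      show "norm ((\<Sum>k<n. mercer_fun k t * ?a k) * f t * exp (- \<beta> * t\<^sup>2))
        \<le> ?C * (exp (t\<^sup>2) * \<bar>f t\<bar> * exp (- \<beta> * t\<^sup>2))"
        using mult_right_mono[OF mercer_partial_bound[of t n], of "\<bar>f t\<bar> * exp (- \<beta> * t\<^sup>2)"]
        by (simp add: abs_mult mult.assoc)
    qed
  qed measurable
  ultimately show ?thesis
    by (simp add: sums_def L2_inner_ae_class kernel_op_measurable)
qed

end

section \<open>Trace and Hilbert--Schmidt norm of the covariance operator\<close>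

lemma L2_inner_self_nn:
  assumes [measurable]: "f \<in> borel_measurable borel" and "ae_class f \<in> L2 \<beta>"
  shows "ennreal (L2_inner \<beta> (ae_class f) (ae_class f)) = (\<integral>\<^sup>+t. ennreal ((f t)\<^sup>2 * exp (- \<beta> * t\<^sup>2)) \<partial>lborel)"
  using assms by (subst nn_integral_eq_integral) (auto simp: ae_class_in_L2_iff L2_inner_ae_class power2_eq_square)

lemma nn_integral_has_bochner:
  assumes "has_bochner_integral M f x" "\<And>t. 0 \<le> f t"
  shows "(\<integral>\<^sup>+t. ennreal (f t) \<partial>M) = ennreal x"
  using assms by (subst nn_integral_eq_integral) (auto simp: has_bochner_integral_iff)

context
  fixes \<beta> :: real and e :: "nat \<Rightarrow> ae_fun" and r :: "nat \<Rightarrow> real \<Rightarrow> real"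
  assumes \<beta>: "\<beta> > 2" and e: "\<And>i. e i \<in> L2 \<beta>"
    and parseval: "\<And>f. f \<in> L2 \<beta> \<Longrightarrow> (\<lambda>i. (L2_inner \<beta> f (e i))\<^sup>2) sums L2_inner \<beta> f f"
    and r [measurable]: "\<And>i. r i \<in> borel_measurable borel" and er: "\<And>i. e i = ae_class (r i)"
begin

lemma parseval_ennreal:
  "f \<in> L2 \<beta> \<Longrightarrow> (\<Sum>i. ennreal ((L2_inner \<beta> f (e i))\<^sup>2)) = ennreal (L2_inner \<beta> f f)"
  by (rule suminf_ennreal_eq[OF _ parseval]) auto

text \<open>After exchanging the two nonnegative sums, Parseval's identity is applied to each
  \<open>mercer_fun k\<close> instead of to the kernel. The trace becomes the sum of their squared
  norms, and summing under the integral restores K(t,t) pointwise.\<close>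

lemma kernel_trace:
  assumes m: "has_bochner_integral lborel (\<lambda>t. limit_kernel t t * exp (- \<beta> * t\<^sup>2)) m"
  shows "(\<Sum>i. ennreal (L2_inner \<beta> (ae_class (kernel_op \<beta> (r i))) (e i))) = ennreal m"
proof -
  have rL: "ae_class (r i) \<in> L2 \<beta>" for i using e[of i] er by simp
  have mL: "ae_class (mercer_fun k) \<in> L2 \<beta>" for k
    by (rule ae_class_in_L2_dominated[OF \<beta>, of _ 1]) (use mercer_fun_bound in auto)
  have K: "(\<Sum>k. ennreal ((mercer_fun k t)\<^sup>2)) = ennreal (limit_kernel t t)" for t
    by (rule suminf_ennreal_eq) (use limit_kernel_sums[of t t] in \<open>auto simp: power2_eq_square\<close>)
  have "(\<Sum>i. ennreal (L2_inner \<beta> (ae_class (kernel_op \<beta> (r i))) (e i)))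
    = (\<Sum>i. \<Sum>k. ennreal ((L2_inner \<beta> (ae_class (mercer_fun k)) (e i))\<^sup>2))"
    unfolding er by (intro suminf_cong suminf_ennreal_eq[symmetric] inner_kernel_op_sums \<beta> r rL) auto
  also have "\<dots> = (\<Sum>k. \<Sum>i. ennreal ((L2_inner \<beta> (ae_class (mercer_fun k)) (e i))\<^sup>2))"
    by (rule ennreal_suminf_swap)
  also have "\<dots> = (\<Sum>k. \<integral>\<^sup>+t. ennreal ((mercer_fun k t)\<^sup>2 * exp (- \<beta> * t\<^sup>2)) \<partial>lborel)"
    by (intro suminf_cong) (simp add: parseval_ennreal mL L2_inner_self_nn)
  also have "\<dots> = (\<integral>\<^sup>+t. (\<Sum>k. ennreal ((mercer_fun k t)\<^sup>2 * exp (- \<beta> * t\<^sup>2))) \<partial>lborel)"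
    by (rule nn_integral_suminf[symmetric]) measurable
  also have "\<dots> = (\<integral>\<^sup>+t. ennreal (limit_kernel t t * exp (- \<beta> * t\<^sup>2)) \<partial>lborel)"
    by (intro nn_integral_cong) (simp add: ennreal_mult'' K)
  also have "\<dots> = ennreal m"
    by (rule nn_integral_has_bochner[OF m]) (simp add: limit_kernel_diagonal_nonneg)
  finally show ?thesis .
qed

text \<open>Parseval's identity is used twice: over \<open>j\<close> for the image of the basis
  vector with index \<open>i\<close>, then over \<open>i\<close> for the kernel section at a fixed
  point \<open>t\<close>.\<close>

lemma kernel_hilbert_schmidt:
  assumes v: "has_bochner_integral lborel
      (\<lambda>t. (LINT s|lborel. (limit_kernel s t)\<^sup>2 * exp (- \<beta> * s\<^sup>2)) * exp (- \<beta> * t\<^sup>2)) v"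
  shows "(\<Sum>i. \<Sum>j. ennreal ((L2_inner \<beta> (ae_class (kernel_op \<beta> (r i))) (e j))\<^sup>2)) = ennreal v"
proof -
  have rL: "ae_class (r i) \<in> L2 \<beta>" for i using e[of i] er by simp
  have KL: "ae_class (limit_kernel t) \<in> L2 \<beta>" for t
    by (rule ae_class_in_L2_dominated[OF \<beta>, of _ "exp (t\<^sup>2)"]) (use limit_kernel_bound in auto)
  note op [measurable] = kernel_op_measurable[OF \<beta> r rL]
  note opL = kernel_op_in_L2[OF \<beta> r rL]
  have sec: "(\<Sum>i. ennreal ((kernel_op \<beta> (r i) t)\<^sup>2)) = ennreal (LINT s|lborel. (limit_kernel s t)\<^sup>2 * exp (- \<beta> * s\<^sup>2))" for t
    unfolding kernel_op_eq_inner[OF \<beta> r rL] er[symmetric] parseval_ennreal[OF KL]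
    by (subst L2_inner_ae_class) (auto simp: power2_eq_square limit_kernel_commute[of t])
  have "(\<Sum>i. \<Sum>j. ennreal ((L2_inner \<beta> (ae_class (kernel_op \<beta> (r i))) (e j))\<^sup>2))
    = (\<Sum>i. \<integral>\<^sup>+t. ennreal ((kernel_op \<beta> (r i) t)\<^sup>2 * exp (- \<beta> * t\<^sup>2)) \<partial>lborel)"
    by (intro suminf_cong) (simp add: parseval_ennreal opL L2_inner_self_nn op)
  also have "\<dots> = (\<integral>\<^sup>+t. (\<Sum>i. ennreal ((kernel_op \<beta> (r i) t)\<^sup>2 * exp (- \<beta> * t\<^sup>2))) \<partial>lborel)"
    by (rule nn_integral_suminf[symmetric]) measurable
  also have "\<dots> = (\<integral>\<^sup>+t. ennreal ((LINT s|lborel. (limit_kernel s t)\<^sup>2 * exp (- \<beta> * s\<^sup>2)) * exp (- \<beta> * t\<^sup>2)) \<partial>lborel)"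
    by (intro nn_integral_cong) (simp add: ennreal_mult'' sec)
  also have "\<dots> = ennreal v"
    by (rule nn_integral_has_bochner[OF v]) simp
  finally show ?thesis .
qed

end

section \<open>Coordinates of the Gaussian element\<close>

lemma space_L2_borel: "space (L2_borel \<beta>) = L2 \<beta>"
proof -
  have "topspace (Metric_space.mtopology (L2 \<beta>) (L2_dist \<beta>)) = L2 \<beta>"
    by (rule Metric_space.topspace_mtopology[OF Metric_space_L2])
  then show ?thesis
    unfolding L2_borel_def by (intro space_measure_of) (auto dest: openin_subset)
qed

lemma gaussian_element_covariance:
  assumes W: "gaussian_element \<beta> M W limit_kernel"
    and [measurable]: "f \<in> borel_measurable borel" "g \<in> borel_measurable borel"
    and L: "ae_class f \<in> L2 \<beta>" "ae_class g \<in> L2 \<beta>" and \<beta>: "\<beta> > 2"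
  shows "(LINT \<omega>|M. L2_inner \<beta> (W \<omega>) (ae_class f) * L2_inner \<beta> (W \<omega>) (ae_class g))
    = L2_inner \<beta> (ae_class (kernel_op \<beta> f)) (ae_class g)"
proof -
  have "(LINT \<omega>|M. L2_inner \<beta> (W \<omega>) (ae_class f) * L2_inner \<beta> (W \<omega>) (ae_class g)) =
        (LINT t|lborel. LINT s|lborel.
           limit_kernel s t * f s * g t * exp (- \<beta> * s\<^sup>2) * exp (- \<beta> * t\<^sup>2))"
    using W L unfolding gaussian_element_def by simp
  also have "\<dots> = (LINT t|lborel. kernel_op \<beta> f t * g t * exp (- \<beta> * t\<^sup>2))"
  proof (intro Bochner_Integration.integral_cong refl)
    fix t
    have "(LINT s|lborel. limit_kernel s t * f s * g t * exp (- \<beta> * s\<^sup>2) * exp (- \<beta> * t\<^sup>2))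
      = (LINT s|lborel. (g t * exp (- \<beta> * t\<^sup>2)) * (limit_kernel s t * f s * exp (- \<beta> * s\<^sup>2)))"
      by (intro Bochner_Integration.integral_cong) (auto simp: mult_ac)
    then show "(LINT s|lborel. limit_kernel s t * f s * g t * exp (- \<beta> * s\<^sup>2) * exp (- \<beta> * t\<^sup>2))
      = kernel_op \<beta> f t * g t * exp (- \<beta> * t\<^sup>2)"
      by (simp add: kernel_op_def)
  qed
  also have "\<dots> = L2_inner \<beta> (ae_class (kernel_op \<beta> f)) (ae_class g)"
    by (rule L2_inner_ae_class[symmetric]) (use kernel_op_measurable \<beta> L in auto)
  finally show ?thesis .
qed

lemma gaussian_element_norm_moments:
  assumes \<beta>: "\<beta> > 2" and M: "prob_space M" and W: "gaussian_element \<beta> M W limit_kernel"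
    and T: "T = (\<lambda>\<omega>. (L2_norm \<beta> (W \<omega>))\<^sup>2)"
    and m: "has_bochner_integral lborel (\<lambda>t. limit_kernel t t * exp (- \<beta> * t\<^sup>2)) m"
    and v: "has_bochner_integral lborel
      (\<lambda>t. (LINT s|lborel. (limit_kernel s t)\<^sup>2 * exp (- \<beta> * s\<^sup>2)) * exp (- \<beta> * t\<^sup>2)) v"
  shows "integrable M T \<and> prob_space.expectation M T = m \<and> integrable M (\<lambda>\<omega>. (T \<omega>)\<^sup>2) \<and>
    prob_space.variance M T = 2 * v"
proof -
  interpret prob_space M by fact
  have "0 < \<beta>" using \<beta> by simp
  then obtain e where e: "\<And>i. e i \<in> L2 \<beta>"
    and parseval: "\<And>f. f \<in> L2 \<beta> \<Longrightarrow> (\<lambda>i. (L2_inner \<beta> f (e i))\<^sup>2) sums L2_inner \<beta> f f"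
    using L2_parseval_system[of \<beta>] by blast
  have "\<exists>f. f \<in> borel_measurable borel \<and> e i = ae_class f" for i
    using ae_fun_cases[of "e i"] by blast
  then obtain r where r: "\<And>i. r i \<in> borel_measurable borel" and er: "\<And>i. e i = ae_class (r i)"
    by metis
  define X where "X i \<omega> = L2_inner \<beta> (W \<omega>) (e i)" for i \<omega>
  have normal: "centred_normal M (\<lambda>\<omega>. L2_inner \<beta> (W \<omega>) f)" if "f \<in> L2 \<beta>" for f
    using W that by (simp add: gaussian_element_def)
  have WL: "W \<omega> \<in> L2 \<beta>" if "\<omega> \<in> space M" for \<omega>
    using W measurable_space[of W M "L2_borel \<beta>" \<omega>] that by (simp add: gaussian_element_def space_L2_borel)
  have lin: "L2_inner \<beta> (W \<omega>) (e i + c *\<^sub>R e j) = X i \<omega> + c * X j \<omega>" if "\<omega> \<in> space M" for i j c \<omega>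
    using L2_inner_add_scaleR_left[OF e e WL[OF that], of i c j]
    by (simp add: X_def L2_inner_commute[of \<beta> "W \<omega>"])
  \<comment> \<open>Linearity of the inner product is known only for \<omega> in
    \<open>space M\<close>, where \<open>W \<omega>\<close> is square integrable; normality must
    therefore be transferred between variables that agree merely there.\<close>
  have normal_cong: "centred_normal M Y \<longleftrightarrow> centred_normal M Z" if "\<And>\<omega>. \<omega> \<in> space M \<Longrightarrow> Y \<omega> = Z \<omega>" for Y Z
    unfolding centred_normal_def distributed_def
    using measurable_cong[of M Y Z borel] measurable_cong[of M Y Z lborel] distr_cong[of M M lborel lborel Y Z]
      AE_cong[of M "\<lambda>\<omega>. Y \<omega> = 0" "\<lambda>\<omega>. Z \<omega> = 0"] that by simp
  have lincomb: "centred_normal M (\<lambda>\<omega>. X i \<omega> + c * X j \<omega>)" for i j c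
    using normal[OF L2_add_scaleR[OF e e]]
      normal_cong[of "\<lambda>\<omega>. L2_inner \<beta> (W \<omega>) (e i + c *\<^sub>R e j)" "\<lambda>\<omega>. X i \<omega> + c * X j \<omega>"] lin
    by blast
  have cov: "expectation (\<lambda>\<omega>. X i \<omega> * X j \<omega>) = L2_inner \<beta> (ae_class (kernel_op \<beta> (r i))) (e j)" for i j
    unfolding X_def er using e er r \<beta> by (intro gaussian_element_covariance[OF W]) auto
  show ?thesis
  proof (rule gaussian_square_sum_moments[of X])
    show "centred_normal M (X i)" for i
      unfolding X_def[abs_def] by (rule normal[OF e])
    show "centred_normal M (\<lambda>\<omega>. X i \<omega> + X j \<omega>)" "centred_normal M (\<lambda>\<omega>. X i \<omega> - X j \<omega>)" for i j
      using lincomb[of i 1 j] lincomb[of i "-1" j] by simp_all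
    show "(\<lambda>i. (X i \<omega>)\<^sup>2) sums T \<omega>" if "\<omega> \<in> space M" for \<omega>
      using parseval[OF WL[OF that]] by (simp add: X_def T L2_norm_power2)
    show "(\<Sum>i. ennreal (expectation (\<lambda>\<omega>. (X i \<omega>)\<^sup>2))) = ennreal m"
      unfolding power2_eq_square cov by (rule kernel_trace[OF \<beta> e parseval r er m])
    show "(\<Sum>i. \<Sum>j. ennreal ((expectation (\<lambda>\<omega>. X i \<omega> * X j \<omega>))\<^sup>2)) = ennreal v"
      unfolding cov by (rule kernel_hilbert_schmidt[OF \<beta> e parseval r er v])
    show "0 \<le> m"
      unfolding has_bochner_integral_integral_eq[OF m, symmetric]
      by (intro integral_nonneg_AE) (simp add: limit_kernel_diagonal_nonneg)
    show "0 \<le> v"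
      unfolding has_bochner_integral_integral_eq[OF v, symmetric] by (intro integral_nonneg_AE) auto
  qed
qed

section \<open>Gaussian integrals\<close>

lemma has_bochner_integral_gaussian_moments:
  assumes a: "0 < (a::real)"
  shows "has_bochner_integral lborel (\<lambda>t. exp (- a * t\<^sup>2)) (sqrt (pi / a))"
    and "has_bochner_integral lborel (\<lambda>t. t * exp (- a * t\<^sup>2)) 0"
    and "has_bochner_integral lborel (\<lambda>t. t\<^sup>2 * exp (- a * t\<^sup>2)) (1 / (2 * a) * sqrt (pi / a))"
    and "has_bochner_integral lborel (\<lambda>t. t ^ 3 * exp (- a * t\<^sup>2)) 0"
    and "has_bochner_integral lborel (\<lambda>t. t ^ 4 * exp (- a * t\<^sup>2)) (3 / (4 * a\<^sup>2) * sqrt (pi / a))"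
  using has_bochner_integral_gaussian_even[OF a, of 0] has_bochner_integral_gaussian_even[OF a, of 1]
    has_bochner_integral_gaussian_even[OF a, of 2] has_bochner_integral_gaussian_odd[OF a, of 0]
    has_bochner_integral_gaussian_odd[OF a, of 1]
  by (simp_all add: fact_numeral power_mult_distrib)

lemma exp_square_shift:
  fixes a c x :: real
  assumes "0 < a"
  shows "exp (c * (c / (2 * a) + x)) * exp (- a * (c / (2 * a) + x)\<^sup>2) = exp (c\<^sup>2 / (4 * a)) * exp (- a * x\<^sup>2)"
  using assms unfolding exp_add[symmetric]
  by (intro arg_cong[where f = exp]) (simp add: power2_eq_square field_simps)

text \<open>Completing the square centres the exponential at c / (2a). Translation by this point
  reduces the integral of a polynomial factor to centred moments of the shifted polynomial.\<close>

lemma has_bochner_integral_gaussian_shift: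
  fixes a c :: real
  assumes a: "0 < a"
  shows "has_bochner_integral lborel (\<lambda>s. exp (c * s) * exp (- a * s\<^sup>2)) (sqrt (pi / a) * exp (c\<^sup>2 / (4 * a)))" (is ?th0)
    and "has_bochner_integral lborel (\<lambda>s. s * (exp (c * s) * exp (- a * s\<^sup>2)))
      (sqrt (pi / a) * exp (c\<^sup>2 / (4 * a)) * (c / (2 * a)))" (is ?th1)
    and "has_bochner_integral lborel (\<lambda>s. s\<^sup>2 * (exp (c * s) * exp (- a * s\<^sup>2)))
      (sqrt (pi / a) * exp (c\<^sup>2 / (4 * a)) * (c\<^sup>2 / (4 * a\<^sup>2) + 1 / (2 * a)))" (is ?th2)
proof -
  let ?m = "c / (2 * a)" and ?E = "exp (c\<^sup>2 / (4 * a))"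
  note m0 = has_bochner_integral_gaussian_moments(1)[OF a]
    and m1 = has_bochner_integral_gaussian_moments(2)[OF a]
    and m2 = has_bochner_integral_gaussian_moments(3)[OF a]
  have shift: "has_bochner_integral lborel (\<lambda>s. q s * (exp (c * s) * exp (- a * s\<^sup>2))) (?E * y)"
    if "has_bochner_integral lborel (\<lambda>x. q (?m + x) * exp (- a * x\<^sup>2)) y" for q :: "real \<Rightarrow> real" and y
  proof (subst lborel_has_bochner_integral_real_affine_iff[of 1 _ _ ?m])
    have eq: "q (?m + x) * (exp (c * (?m + x)) * exp (- a * (?m + x)\<^sup>2)) = ?E * (q (?m + x) * exp (- a * x\<^sup>2))" for x
      unfolding exp_square_shift[OF a] by simp
    then show "has_bochner_integral lborel (\<lambda>x. q (?m + 1 * x) * (exp (c * (?m + 1 * x)) * exp (- a * (?m + 1 * x)\<^sup>2)))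
       ((?E * y) /\<^sub>R \<bar>1\<bar>)"
      using has_bochner_integral_mult_right[OF that, of ?E]
      by (simp only: mult_1 eq abs_one inverse_1 scaleR_one)
  qed simp
  show ?th0
    using shift[of "\<lambda>_. 1", OF has_bochner_integral_cong[THEN iffD1, OF refl _ refl m0]]
    by (simp add: mult.commute)
  have "has_bochner_integral lborel (\<lambda>x. ?m * exp (- a * x\<^sup>2) + x * exp (- a * x\<^sup>2)) (?m * sqrt (pi / a) + 0)"
    by (intro has_bochner_integral_add has_bochner_integral_mult_right m0 m1)
  then have "has_bochner_integral lborel (\<lambda>x. (?m + x) * exp (- a * x\<^sup>2)) (?m * sqrt (pi / a))"
    by (simp add: distrib_right)
  from shift[of "\<lambda>x. x", OF this] show ?th1
    by (simp add: mult_ac)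
  have "has_bochner_integral lborel (\<lambda>x. ?m\<^sup>2 * exp (- a * x\<^sup>2) + 2 * ?m * (x * exp (- a * x\<^sup>2)) + x\<^sup>2 * exp (- a * x\<^sup>2))
     (?m\<^sup>2 * sqrt (pi / a) + 2 * ?m * 0 + 1 / (2 * a) * sqrt (pi / a))"
    by (intro has_bochner_integral_add has_bochner_integral_mult_right m0 m1 m2)
  moreover have "?m\<^sup>2 * exp (- a * x\<^sup>2) + 2 * ?m * (x * exp (- a * x\<^sup>2)) + x\<^sup>2 * exp (- a * x\<^sup>2)
    = (?m + x)\<^sup>2 * exp (- a * x\<^sup>2)" for x
    by (simp add: power2_sum algebra_simps)
  ultimately have "has_bochner_integral lborel (\<lambda>x. (?m + x)\<^sup>2 * exp (- a * x\<^sup>2))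
     (?m\<^sup>2 * sqrt (pi / a) + 2 * ?m * 0 + 1 / (2 * a) * sqrt (pi / a))" by simp
  from shift[of "\<lambda>x. x\<^sup>2", OF this] show ?th2
    by (simp add: power_divide power_mult_distrib algebra_simps)
qed

text \<open>On the diagonal e^(ts) combines with the prefactor to e^(2 t^2), while the subtracted
  polynomial 1 + t^2 + t^4 / 2 keeps the factor e^(t^2). This explains the rates \<beta> - 2 and
  \<beta> - 1.\<close>

lemma limit_kernel_diagonal_integral:
  assumes \<beta>: "\<beta> > 2"
  shows "has_bochner_integral lborel (\<lambda>t. limit_kernel t t * exp (- \<beta> * t\<^sup>2))
    (sqrt pi / sqrt (\<beta> - 2) - sqrt pi / sqrt (\<beta> - 1) * (1 + 1 / (2 * (\<beta> - 1)) + 3 / (8 * (\<beta> - 1)\<^sup>2)))"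
proof -
  have pos: "0 < \<beta> - 2" "0 < \<beta> - 1" using \<beta> by auto
  have "has_bochner_integral lborel (\<lambda>t. exp (- (\<beta> - 2) * t\<^sup>2) -
      (exp (- (\<beta> - 1) * t\<^sup>2) + t\<^sup>2 * exp (- (\<beta> - 1) * t\<^sup>2) + 1 / 2 * (t ^ 4 * exp (- (\<beta> - 1) * t\<^sup>2))))
    (sqrt (pi / (\<beta> - 2)) - (sqrt (pi / (\<beta> - 1)) + 1 / (2 * (\<beta> - 1)) * sqrt (pi / (\<beta> - 1))
      + 1 / 2 * (3 / (4 * (\<beta> - 1)\<^sup>2) * sqrt (pi / (\<beta> - 1)))))"
    by (intro has_bochner_integral_add has_bochner_integral_diff has_bochner_integral_mult_right
        has_bochner_integral_gaussian_moments pos)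
  moreover have "exp (- (\<beta> - 2) * t\<^sup>2) -
      (exp (- (\<beta> - 1) * t\<^sup>2) + t\<^sup>2 * exp (- (\<beta> - 1) * t\<^sup>2) + 1 / 2 * (t ^ 4 * exp (- (\<beta> - 1) * t\<^sup>2)))
      = limit_kernel t t * exp (- \<beta> * t\<^sup>2)" for t
  proof -
    have "exp (- (\<beta> - 2) * t\<^sup>2) = exp (t\<^sup>2) * exp (t\<^sup>2) * exp (- \<beta> * t\<^sup>2)"
      "exp (- (\<beta> - 1) * t\<^sup>2) = exp (t\<^sup>2) * exp (- \<beta> * t\<^sup>2)"
      unfolding exp_add[symmetric] by (simp_all add: algebra_simps)
    then show ?thesis
      by (simp add: limit_kernel_def power2_eq_square[symmetric] algebra_simps power4_eq_xxxx)
  qed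
  ultimately show ?thesis
    by (simp add: real_sqrt_divide algebra_simps)
qed

lemma limit_kernel_square_integral:
  fixes \<beta> t :: real
  defines "a \<equiv> \<beta> - 1"
  assumes \<beta>: "\<beta> > 2"
  shows "has_bochner_integral lborel (\<lambda>s. (limit_kernel s t)\<^sup>2 * exp (- \<beta> * s\<^sup>2))
    (exp (t\<^sup>2) * (sqrt (pi / a) * (exp (t\<^sup>2 / a) - 2 * exp (t\<^sup>2 / (4 * a)) * (1 + 3 * t\<^sup>2 / (4 * a) + t ^ 4 / (8 * a\<^sup>2))
      + (1 + t\<^sup>2 / a + 3 * t ^ 4 / (16 * a\<^sup>2)))))"
proof -
  have a: "0 < a" using \<beta> by (simp add: a_def)
  note gs = has_bochner_integral_gaussian_shift[OF a]
  let ?w = "\<lambda>s. exp (- a * s\<^sup>2)"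
  \<comment> \<open>This is the expansion of (e^(ts) - p)^2 with p = 1 + ts + t^2 s^2 / 2. The
    squared prefactor contributes e^(s^2), which turns the rate \<beta> into a = \<beta> - 1, and
    e^(t^2), which is constant here.\<close>
  have "has_bochner_integral lborel (\<lambda>s. exp (t\<^sup>2) * (exp (2 * t * s) * ?w s
     - 2 * (exp (t * s) * ?w s + t * (s * (exp (t * s) * ?w s)) + t\<^sup>2 / 2 * (s\<^sup>2 * (exp (t * s) * ?w s)))
     + (?w s + 2 * t * (s * ?w s) + 2 * t\<^sup>2 * (s\<^sup>2 * ?w s) + t ^ 3 * (s ^ 3 * ?w s) + t ^ 4 / 4 * (s ^ 4 * ?w s))))
   (exp (t\<^sup>2) * (sqrt (pi / a) * exp ((2 * t)\<^sup>2 / (4 * a))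
     - 2 * (sqrt (pi / a) * exp (t\<^sup>2 / (4 * a)) + t * (sqrt (pi / a) * exp (t\<^sup>2 / (4 * a)) * (t / (2 * a)))
       + t\<^sup>2 / 2 * (sqrt (pi / a) * exp (t\<^sup>2 / (4 * a)) * (t\<^sup>2 / (4 * a\<^sup>2) + 1 / (2 * a))))
     + (sqrt (pi / a) + 2 * t * 0 + 2 * t\<^sup>2 * (1 / (2 * a) * sqrt (pi / a)) + t ^ 3 * 0
       + t ^ 4 / 4 * (3 / (4 * a\<^sup>2) * sqrt (pi / a)))))"
    by (intro has_bochner_integral_add has_bochner_integral_diff has_bochner_integral_mult_right gs
        has_bochner_integral_gaussian_moments a)
  moreover have "exp (t\<^sup>2) * (exp (2 * t * s) * ?w s
     - 2 * (exp (t * s) * ?w s + t * (s * (exp (t * s) * ?w s)) + t\<^sup>2 / 2 * (s\<^sup>2 * (exp (t * s) * ?w s)))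
     + (?w s + 2 * t * (s * ?w s) + 2 * t\<^sup>2 * (s\<^sup>2 * ?w s) + t ^ 3 * (s ^ 3 * ?w s) + t ^ 4 / 4 * (s ^ 4 * ?w s)))
     = (limit_kernel s t)\<^sup>2 * exp (- \<beta> * s\<^sup>2)" for s
  proof -
    have e1: "(exp ((t\<^sup>2 + s\<^sup>2) / 2))\<^sup>2 * exp (- \<beta> * s\<^sup>2) = exp (t\<^sup>2) * ?w s"
      unfolding power2_eq_square exp_add[symmetric] a_def by (simp add: field_simps)
    have e2: "exp (2 * t * s) = exp (t * s) * exp (t * s)"
      unfolding exp_add[symmetric] by simp
    have "(limit_kernel s t)\<^sup>2 * exp (- \<beta> * s\<^sup>2)
      = ((exp ((t\<^sup>2 + s\<^sup>2) / 2))\<^sup>2 * exp (- \<beta> * s\<^sup>2)) * (exp (t * s) - 1 - t * s - t\<^sup>2 * s\<^sup>2 / 2)\<^sup>2"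
      by (simp add: limit_kernel_def power_mult_distrib)
    also have "\<dots> = exp (t\<^sup>2) * ?w s * (exp (t * s) - 1 - t * s - t\<^sup>2 * s\<^sup>2 / 2)\<^sup>2"
      unfolding e1 ..
    finally show ?thesis
      unfolding e2 by (simp add: field_simps power2_eq_square power3_eq_cube power4_eq_xxxx)
  qed
  moreover have "exp (t\<^sup>2) * (sqrt (pi / a) * exp ((2 * t)\<^sup>2 / (4 * a))
     - 2 * (sqrt (pi / a) * exp (t\<^sup>2 / (4 * a)) + t * (sqrt (pi / a) * exp (t\<^sup>2 / (4 * a)) * (t / (2 * a)))
       + t\<^sup>2 / 2 * (sqrt (pi / a) * exp (t\<^sup>2 / (4 * a)) * (t\<^sup>2 / (4 * a\<^sup>2) + 1 / (2 * a))))
     + (sqrt (pi / a) + 2 * t * 0 + 2 * t\<^sup>2 * (1 / (2 * a) * sqrt (pi / a)) + t ^ 3 * 0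
       + t ^ 4 / 4 * (3 / (4 * a\<^sup>2) * sqrt (pi / a))))
    = exp (t\<^sup>2) * (sqrt (pi / a) * (exp (t\<^sup>2 / a) - 2 * exp (t\<^sup>2 / (4 * a)) * (1 + 3 * t\<^sup>2 / (4 * a) + t ^ 4 / (8 * a\<^sup>2))
      + (1 + t\<^sup>2 / a + 3 * t ^ 4 / (16 * a\<^sup>2))))"
  proof -
    have e: "(2 * t)\<^sup>2 / (4 * a) = t\<^sup>2 / a" by (simp add: power_mult_distrib)
    show ?thesis unfolding e using a by (simp add: field_simps power2_eq_square power4_eq_xxxx)
  qed
  ultimately show ?thesis by simp
qed

text \<open>The inner integral leaves three kinds of exponentials in \<open>t\<close>, coming from
  e^(2ts), from the mixed term and from the squared polynomial. The outer integral is again a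
  combination of moments of orders 0, 2 and 4.\<close>

lemma limit_kernel_double_integral:
  fixes \<beta> \<gamma> :: real
  assumes \<beta>: "\<beta> > 2" and \<gamma>: "\<gamma> = 4 * (\<beta> - 1)\<^sup>2 - 1"
  shows "has_bochner_integral lborel
    (\<lambda>t. (LINT s|lborel. (limit_kernel s t)\<^sup>2 * exp (- \<beta> * s\<^sup>2)) * exp (- \<beta> * t\<^sup>2))
    (pi * (1 / (sqrt \<beta> * sqrt (\<beta> - 2)) - 4 / sqrt \<gamma> - 6 / \<gamma> powr (3 / 2) - 6 / \<gamma> powr (5 / 2)
      + 1 / (\<beta> - 1) + 1 / (2 * (\<beta> - 1) ^ 3) + 9 / (64 * (\<beta> - 1) ^ 5)))"
proof -
  define a where "a = \<beta> - 1"
  \<comment> \<open>The rates \<open>b\<close> and \<open>c\<close> are what remains of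
    \<open>a\<close> after the factors e^(t^2 / a) and e^(t^2 / (4a)) of the inner integral. Their
    products with \<open>a\<close> are \<beta> (\<beta> - 2) and \<gamma> / 4, which is the origin
    of the roots in the result and of the constant \<gamma>.\<close>
  define b where "b = a - 1 / a"
  define c where "c = a - 1 / (4 * a)"
  have a: "a > 1" using \<beta> by (simp add: a_def)
  have \<gamma>': "\<gamma> = 4 * a\<^sup>2 - 1" by (simp add: \<gamma> a_def)
  have "1 < a\<^sup>2" using a by (simp add: one_less_power)
  then have \<gamma>0: "\<gamma> > 0" unfolding \<gamma>' by simp
  have ab: "a * b = \<beta> * (\<beta> - 2)" and ac: "a * c = \<gamma> / 4"
    using a unfolding \<gamma>' b_def c_def by (simp_all add: field_simps power2_eq_square a_def)
  have b: "b > 0" using ab \<beta> a by (metis diff_gt_0_iff_gt mult_pos_pos order_less_trans zero_less_mult_pos zero_less_numeral zero_less_one)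
  have c: "c > 0" using ac \<gamma>0 a by (metis divide_pos_pos order_less_trans zero_less_mult_pos zero_less_numeral zero_less_one)
  have a0: "0 < a" using a by simp
  have "has_bochner_integral lborel (\<lambda>t. sqrt (pi / a) * (exp (- b * t\<^sup>2)
      - 2 * (exp (- c * t\<^sup>2) + 3 / (4 * a) * (t\<^sup>2 * exp (- c * t\<^sup>2)) + 1 / (8 * a\<^sup>2) * (t ^ 4 * exp (- c * t\<^sup>2)))
      + (exp (- a * t\<^sup>2) + 1 / a * (t\<^sup>2 * exp (- a * t\<^sup>2)) + 3 / (16 * a\<^sup>2) * (t ^ 4 * exp (- a * t\<^sup>2)))))
    (sqrt (pi / a) * (sqrt (pi / b)
      - 2 * (sqrt (pi / c) + 3 / (4 * a) * (1 / (2 * c) * sqrt (pi / c)) + 1 / (8 * a\<^sup>2) * (3 / (4 * c\<^sup>2) * sqrt (pi / c)))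
      + (sqrt (pi / a) + 1 / a * (1 / (2 * a) * sqrt (pi / a)) + 3 / (16 * a\<^sup>2) * (3 / (4 * a\<^sup>2) * sqrt (pi / a)))))"
    by (intro has_bochner_integral_add has_bochner_integral_diff has_bochner_integral_mult_right
        has_bochner_integral_gaussian_moments a0 b c)
  moreover have "sqrt (pi / a) * (exp (- b * t\<^sup>2)
      - 2 * (exp (- c * t\<^sup>2) + 3 / (4 * a) * (t\<^sup>2 * exp (- c * t\<^sup>2)) + 1 / (8 * a\<^sup>2) * (t ^ 4 * exp (- c * t\<^sup>2)))
      + (exp (- a * t\<^sup>2) + 1 / a * (t\<^sup>2 * exp (- a * t\<^sup>2)) + 3 / (16 * a\<^sup>2) * (t ^ 4 * exp (- a * t\<^sup>2))))
    = (LINT s|lborel. (limit_kernel s t)\<^sup>2 * exp (- \<beta> * s\<^sup>2)) * exp (- \<beta> * t\<^sup>2)" for t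
  proof -
    have e: "exp (- a * t\<^sup>2) = exp (t\<^sup>2) * exp (- \<beta> * t\<^sup>2)"
      "exp (- b * t\<^sup>2) = exp (t\<^sup>2 / a) * (exp (t\<^sup>2) * exp (- \<beta> * t\<^sup>2))"
      "exp (- c * t\<^sup>2) = exp (t\<^sup>2 / (4 * a)) * (exp (t\<^sup>2) * exp (- \<beta> * t\<^sup>2))"
      unfolding exp_add[symmetric] b_def c_def by (simp_all add: a_def algebra_simps)
    show ?thesis
      unfolding e has_bochner_integral_integral_eq[OF limit_kernel_square_integral[OF \<beta>, of t, folded a_def]]
      by (simp add: algebra_simps)
  qed
  moreover have "sqrt (pi / a) * (sqrt (pi / b)
      - 2 * (sqrt (pi / c) + 3 / (4 * a) * (1 / (2 * c) * sqrt (pi / c)) + 1 / (8 * a\<^sup>2) * (3 / (4 * c\<^sup>2) * sqrt (pi / c)))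
      + (sqrt (pi / a) + 1 / a * (1 / (2 * a) * sqrt (pi / a)) + 3 / (16 * a\<^sup>2) * (3 / (4 * a\<^sup>2) * sqrt (pi / a))))
    = pi * (1 / (sqrt \<beta> * sqrt (\<beta> - 2)) - 4 / sqrt \<gamma> - 6 / \<gamma> powr (3 / 2) - 6 / \<gamma> powr (5 / 2)
      + 1 / (\<beta> - 1) + 1 / (2 * (\<beta> - 1) ^ 3) + 9 / (64 * (\<beta> - 1) ^ 5))"
  proof -
    have prod: "sqrt (pi / x) * sqrt (pi / y) = pi / sqrt (x * y)" for x y :: real
      by (simp add: real_sqrt_divide real_sqrt_mult)
    have 1: "sqrt (pi / a) * sqrt (pi / b) = pi * (1 / (sqrt \<beta> * sqrt (\<beta> - 2)))"
      unfolding prod ab by (simp add: real_sqrt_mult)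
    have 2: "sqrt (pi / a) * sqrt (pi / c) = pi * (2 / sqrt \<gamma>)"
      unfolding prod ac by (simp add: real_sqrt_divide)
    have 3: "sqrt (pi / a) * sqrt (pi / a) = pi * (1 / a)"
      using a0 by simp
    have p3: "\<gamma> powr (3 / 2) = \<gamma> * sqrt \<gamma>"
      using \<gamma>0 powr_add[of \<gamma> 1 "1/2"] by (simp add: powr_half_sqrt)
    have p5: "\<gamma> powr (5 / 2) = \<gamma>\<^sup>2 * sqrt \<gamma>"
      using \<gamma>0 powr_add[of \<gamma> 2 "1/2"] by (simp add: powr_half_sqrt)
    have c_eq: "c = \<gamma> / (4 * a)" using ac a0 by (simp add: field_simps)
    \<comment> \<open>Groups the terms so that square roots occur only in the three products
      evaluated above; the remaining factors are rational in \<open>a\<close> and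
      \<open>c\<close>.\<close>
    have factor: "x * (y - 2 * (z + p * (q * z) + r * (u * z)) + (x + d * (e * x) + f * (g * x)))
      = x * y - 2 * (x * z) * (1 + p * q + r * u) + (x * x) * (1 + d * e + f * g)"
      for x y z p q r u d e f g :: real by (simp add: algebra_simps)
    have "sqrt (pi / a) * (sqrt (pi / b)
      - 2 * (sqrt (pi / c) + 3 / (4 * a) * (1 / (2 * c) * sqrt (pi / c)) + 1 / (8 * a\<^sup>2) * (3 / (4 * c\<^sup>2) * sqrt (pi / c)))
      + (sqrt (pi / a) + 1 / a * (1 / (2 * a) * sqrt (pi / a)) + 3 / (16 * a\<^sup>2) * (3 / (4 * a\<^sup>2) * sqrt (pi / a))))
      = sqrt (pi / a) * sqrt (pi / b)
      - 2 * (sqrt (pi / a) * sqrt (pi / c)) * (1 + 3 / (4 * a) * (1 / (2 * c)) + 1 / (8 * a\<^sup>2) * (3 / (4 * c\<^sup>2)))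
      + (sqrt (pi / a) * sqrt (pi / a)) * (1 + 1 / a * (1 / (2 * a)) + 3 / (16 * a\<^sup>2) * (3 / (4 * a\<^sup>2)))"
      by (rule factor)
    also have "\<dots> = pi * (1 / (sqrt \<beta> * sqrt (\<beta> - 2)))
      - pi * (4 / sqrt \<gamma>) * (1 + 3 / (4 * a) * (1 / (2 * c)) + 1 / (8 * a\<^sup>2) * (3 / (4 * c\<^sup>2)))
      + pi * (1 / a) * (1 + 1 / a * (1 / (2 * a)) + 3 / (16 * a\<^sup>2) * (3 / (4 * a\<^sup>2)))"
      unfolding 1 2 3 by simp
    also have "3 / (4 * a) * (1 / (2 * c)) = 3 / (2 * \<gamma>)"
      using a0 \<gamma>0 by (simp add: c_eq)
    also have "1 / (8 * a\<^sup>2) * (3 / (4 * c\<^sup>2)) = 3 / (2 * \<gamma>\<^sup>2)"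
      using a0 \<gamma>0 by (simp add: c_eq field_simps power2_eq_square)
    \<comment> \<open>Multiplying out yields 4 * 3 / 2 = 6 for both half-integer powers of
      \<gamma>.\<close>
    also have "pi * (4 / sqrt \<gamma>) * (1 + 3 / (2 * \<gamma>) + 3 / (2 * \<gamma>\<^sup>2))
      = pi * (4 / sqrt \<gamma> + 6 / \<gamma> powr (3 / 2) + 6 / \<gamma> powr (5 / 2))"
      unfolding p3 p5 by (simp add: distrib_left distrib_right mult.commute)
    also have "pi * (1 / a) * (1 + 1 / a * (1 / (2 * a)) + 3 / (16 * a\<^sup>2) * (3 / (4 * a\<^sup>2)))
      = pi * (1 / a + 1 / (2 * a ^ 3) + 9 / (64 * a ^ 5))"
      using a0 by (simp add: field_simps eval_nat_numeral)
    finally show ?thesis by (simp add: a_def algebra_simps)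
  qed
  ultimately show ?thesis by simp
qed

theorem theorem2:
  fixes \<beta> \<gamma> :: real
    and M :: "'a measure"
    and W :: "'a \<Rightarrow> ae_fun"
    and T :: "'a \<Rightarrow> real"
  assumes "\<beta> > 2"
    and "prob_space M"
    and "gaussian_element \<beta> M W limit_kernel"
    and T: "T = (\<lambda>\<omega>. (L2_norm \<beta> (W \<omega>))\<^sup>2)"
    and \<gamma>: "\<gamma> = 4 * (\<beta> - 1)\<^sup>2 - 1"
  shows "integrable M T \<and>
         prob_space.expectation M T =
           sqrt pi / sqrt (\<beta> - 2)
           - sqrt pi / sqrt (\<beta> - 1) * (1 + 1 / (2 * (\<beta> - 1)) + 3 / (8 * (\<beta> - 1)\<^sup>2)) \<and>
         integrable M (\<lambda>\<omega>. (T \<omega>)\<^sup>2) \<and>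
         prob_space.variance M T =
           2 * pi * (1 / (sqrt \<beta> * sqrt (\<beta> - 2)) - 4 / sqrt \<gamma>
             - 6 / \<gamma> powr (3 / 2) - 6 / \<gamma> powr (5 / 2)
             + 1 / (\<beta> - 1) + 1 / (2 * (\<beta> - 1) ^ 3) + 9 / (64 * (\<beta> - 1) ^ 5))"
proof -
  note moments = gaussian_element_norm_moments[OF assms(1-3) T limit_kernel_diagonal_integral[OF assms(1)]
      limit_kernel_double_integral[OF assms(1) \<gamma>]]
  show ?thesis
    unfolding mult.assoc[of 2 pi] by (rule moments)
qed

end
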